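(* Let $\{\mu_n\}_{n\ge 1}$ be a sequence of probability measures on $\mathbb{Z}$ with asymptotically trivial transforms. Then there exists a subsequence $\{n_k\}$ such that for every dynamical system $(X,\mathcal{F},m,\tau)$ and every $f\in L^1(X)$, the sequence of weighted averages $\mu_{n_k}f(x)$ converges as $k\to\infty$ for $m$-almost every $x\in X$.
   Context: Write $e(\gamma)=e^{2\pi i\gamma}$ and, for a measure $\mu$ on $\mathbb{Z}$, $\hat\mu(\gamma)=\sum_{j\in\mathbb{Z}}\mu(j)e(j\gamma)$ for $\gamma\in[0,1)$. A sequence $\{\mu_n\}$ of probability measures on $\mathbb{Z}$ has asymptotically trivial transforms if $\hat\mu_n$ converges to $0$ uniformly on every compact subset of $(0,1)$, or equivalently if $\sup_{\gamma\in[0,1)}|(1-e(\gamma))\hat\mu_n(\gamma)|\to 0$ as $n\to\infty$. A dynamical system $(X,\mathcal{F},m,\tau)$ is a probability space $(X,\mathcal{F},m)$ with an invertible measure-preserving transformation $\tau$. For a measure $\mu$ on $\mathbb{Z}$ with finite total variation and $f\in L^1(X)$, the weighted average is $\mu f(x):=\sum_{j\in\mathbb{Z}}f(\tau^jx)\mu(j)$. *)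

theory Defs
  imports "HOL-Probability.Probability"
begin

definition e :: "real \<Rightarrow> complex" where
  "e \<gamma> = exp (2 * of_real pi * \<i> * of_real \<gamma>)"

definition fourier_transform :: "int pmf \<Rightarrow> real \<Rightarrow> complex" where
  "fourier_transform \<mu> \<gamma> = (\<Sum>\<^sub>\<infinity>j\<in>UNIV. of_real (pmf \<mu> j) * e (of_int j * \<gamma>))"

definition asymptotically_trivial_transforms :: "(nat \<Rightarrow> int pmf) \<Rightarrow> bool" where
  "asymptotically_trivial_transforms \<mu> \<longleftrightarrow>
     (\<forall>K. compact K \<and> K \<subseteq> {0<..<1} \<longrightarrow>
        uniform_limit K (\<lambda>n \<gamma>. fourier_transform (\<mu> n) \<gamma>) (\<lambda>_. 0) sequentially)"

locale dynamical_system = prob_space M for M :: "'a measure" +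
  fixes \<tau> :: "'a \<Rightarrow> 'a"
  assumes bij_\<tau>: "bij_betw \<tau> (space M) (space M)"
    and measurable_\<tau>: "\<tau> \<in> measurable M M"
    and measurable_inv_\<tau>: "inv_into (space M) \<tau> \<in> measurable M M"
    and preserving_\<tau>: "distr M M \<tau> = M"

text \<open>The power \<open>\<tau>\<^sup>j\<close> for \<open>j \<in> \<int>\<close>. The inverse is taken relative to \<open>space M\<close>,
  since \<open>\<tau>\<close> is unconstrained outside that set.\<close>

definition int_iterate :: "'a measure \<Rightarrow> ('a \<Rightarrow> 'a) \<Rightarrow> int \<Rightarrow> 'a \<Rightarrow> 'a" where
  "int_iterate M \<tau> j =
     (if 0 \<le> j then \<tau> ^^ nat j else inv_into (space M) \<tau> ^^ nat (- j))"

text \<open>For integrable \<open>f\<close> the sum converges absolutely at almost every point; \<open>infsum\<close> is \<open>0\<close>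
  on the exceptional null set.\<close>

definition weighted_average ::
  "'a measure \<Rightarrow> ('a \<Rightarrow> 'a) \<Rightarrow> int pmf \<Rightarrow> ('a \<Rightarrow> complex) \<Rightarrow> 'a \<Rightarrow> complex" where
  "weighted_average M \<tau> \<mu> f x =
     (\<Sum>\<^sub>\<infinity>j\<in>UNIV. f (int_iterate M \<tau> j x) * of_real (pmf \<mu> j))"

definition ae_convergent_along ::
  "'a itself \<Rightarrow> (nat \<Rightarrow> int pmf) \<Rightarrow> (nat \<Rightarrow> nat) \<Rightarrow> bool" where
  "ae_convergent_along (_ :: 'a itself) \<mu> r \<longleftrightarrow>
     (\<forall>(M :: 'a measure) \<tau> f. dynamical_system M \<tau> \<and> integrable M f \<longrightarrow>
        (AE x in M. convergent (\<lambda>k. weighted_average M \<tau> (\<mu> (r k)) f x)))"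

text \<open>One subsequence has to serve the dynamical systems on \<^emph>\<open>all\<close> types, but a formula of the
  form \<open>\<exists>r. \<forall>(M :: 'a measure) \<tau> f. \<dots>\<close> would let \<open>r\<close> depend on the type \<open>'a\<close>. Naming
  the witness by a constant without type parameter rules this out: \<open>universal_subseq \<mu>\<close>
  depends on \<open>\<mu>\<close> only. The choice is made among the subsequences that work for all systems on
  \<open>int \<Rightarrow> complex\<close>; every pair of a system \<open>(M, \<tau>)\<close> and an \<open>f\<close> has a factor there, under
  \<open>x \<mapsto> (f (\<tau>\<^sup>j x))\<^sub>j\<close>. That a choice exists, and that it works on other types, is not
  assumed.\<close>

definition universal_subseq :: "(nat \<Rightarrow> int pmf) \<Rightarrow> nat \<Rightarrow> nat" where
  "universal_subseq \<mu> =
     (SOME r. strict_mono r \<and> ae_convergent_along TYPE(int \<Rightarrow> complex) \<mu> r)"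

end

theory Submission
  imports Defs
begin

text \<open>
  Choose the subsequence \<open>n\<^sub>k\<close> together with radii \<open>R\<^sub>k = 2 ^ A k\<close> so that \<open>\<mu>\<^bsub>n\<^sub>k\<^esub>\<close> lives, up to a mass
  \<open>2\<^sup>-\<^sup>k\<close>, on \<open>[-R\<^sub>k\<^sub>+\<^sub>1, R\<^sub>k\<^sub>+\<^sub>1]\<close>, while \<open>(1 - e(\<gamma>))\<close> times its transform is at most
  \<open>2\<^sup>-\<^sup>k / R\<^sub>k\<close>. Along such a sequence the maximal function is of weak type (1,1). On \<open>\<int>\<close>, make a
  dyadic Calderon--Zygmund decomposition at height \<open>\<alpha>\<close>. For the \<open>k\<close>-th weight, bad intervals longer
  than \<open>R\<^sub>k\<^sub>+\<^sub>1\<close> only influence their threefold enlargements; those of length in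
  \<open>(R\<^sub>k, R\<^sub>k\<^sub>+\<^sub>1]\<close> belong to a single \<open>k\<close>, so that the trivial \<open>\<ell>\<^sup>1\<close> bound suffices; on those of
  length at most \<open>R\<^sub>k\<close> the mean zero part is the difference \<open>c(i + 1) - c(i)\<close> of a function \<open>c\<close>
  that is small in \<open>\<ell>\<^sup>2\<close>, and Parseval's identity applies. Transference carries the bound over to
  dynamical systems. Invariant functions plus bounded coboundaries are dense in \<open>L\<^sup>1\<close>, and for a
  coboundary the \<open>L\<^sup>2\<close> norms of the averages are summable in \<open>k\<close> by the same Parseval argument.
\<close>

section \<open>An \<open>\<ell>\<^sup>2\<close> bound for differences\<close>

text \<open>The hypothesis controls only (1 - e(\<gamma>)) times a transform, so it acts on
  differences alone, and no smoothness of the weights can make up for that. A mean zero function on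
  an interval of length at most \<open>R_k\<close> is a difference, at the price of a factor
  \<open>R_k\<close> in its primitive. This dictates the order of choice: the k-th measure comes
  after \<open>R_k\<close>, so that its transform can absorb that factor, and \<open>R_(k+1)\<close>
  comes after the measure, so that it can catch its mass. Lengths between the two radii escape both
  arguments. They are affordable because the gaps for different k are disjoint, so all the trivial
  bounds together cost the mass of the function once; the spare factor 2^-k sums the cancelling
  parts. Functions on an orbit are cut to finite support throughout, so that roots of unity replace
  integrals over the circle.\<close>

lemma e_cis: "e x = cis (2 * pi * x)"
  by (simp add: e_def cis_conv_exp mult_ac)

lemma norm_e [simp]: "norm (e x) = 1"
  by (simp add: e_cis)

lemma e_add: "e (x + y) = e x * e y"
  by (simp add: e_cis cis_mult algebra_simps)

lemma e_minus: "e (- x) = cnj (e x)"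
  by (simp add: e_cis cis_cnj)

lemma e_0 [simp]: "e 0 = 1"
  by (simp add: e_cis)

lemma e_mult_nat: "e (x * real n) = e x ^ n"
  by (simp add: e_cis Complex.DeMoivre mult_ac)

lemma e_eq_1_iff: "e x = 1 \<longleftrightarrow> x \<in> \<int>"
proof
  assume "e x = 1"
  then obtain n :: int where "2 * pi * x = of_int (2 * n) * pi"
    by (auto simp: e_def exp_eq_1)
  then have "x = of_int n" by simp
  then show "x \<in> \<int>" by simp
next
  assume "x \<in> \<int>"
  then obtain n where n: "x = of_int n" by (auto elim: Ints_cases)
  have "cos (2 * pi * real_of_int n) = 1" "sin (2 * pi * real_of_int n) = 0"
    using cos_int_2pin sin_int_2pin by (auto simp: mult_ac)
  then show "e x = 1" using n by (simp add: e_cis complex_eq_iff)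
qed

text \<open>The terms are powers of an N-th root of unity, which for 0 < |m| < N differs from 1, so
  the geometric sum vanishes.\<close>

lemma sum_e_roots:
  assumes "\<bar>m\<bar> < int N"
  shows "(\<Sum>r<N. e (of_int m * (real r / real N))) = (if m = 0 then of_nat N else 0)"
proof (cases "m = 0")
  case False
  define z where "z = e (of_int m / real N)"
  have N: "N > 0" using assms by linarith
  have "of_int m / real N \<notin> \<int>"
  proof
    assume "of_int m / real N \<in> \<int>"
    then obtain q where "of_int m / real N = of_int q" by (auto elim: Ints_cases)
    then have "real_of_int m = of_int (q * int N)" using N by (simp add: field_simps)
    then have "m = q * int N" by (simp only: of_int_eq_iff)
    then show False using assms False
      by (metis abs_mult abs_of_nat dvd_triv_right zdvd_not_zless abs_ge_zero abs_0_eq dvd_abs_iff linorder_not_le order_le_less)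
  qed
  then have z1: "z \<noteq> 1" by (simp add: z_def e_eq_1_iff)
  have "z ^ N = e (of_int m / real N * real N)" by (simp only: z_def e_mult_nat)
  also have "\<dots> = 1" using N by (simp add: e_eq_1_iff)
  finally have zN: "z ^ N = 1" .
  have "(\<Sum>r<N. e (of_int m * (real r / real N))) = (\<Sum>r<N. z ^ r)"
    by (intro sum.cong refl) (simp add: z_def flip: e_mult_nat)
  also have "\<dots> = 0" using z1 zN by (simp add: geometric_sum)
  finally show ?thesis using False by simp
qed auto

text \<open>Frequencies in [-B, B] differ by at most 2 B < N, so distinct ones stay orthogonal when
  sampled at the N-th roots of unity.\<close>

lemma discrete_parseval:
  fixes w :: "int \<Rightarrow> complex"
  assumes X: "X \<subseteq> {-B..B}" and N: "2 * B < int N"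
  shows "(\<Sum>r<N. (norm (\<Sum>i\<in>X. w i * e (of_int i * (real r / real N))))\<^sup>2)
           = real N * (\<Sum>i\<in>X. (norm (w i))\<^sup>2)"
proof -
  have fX: "finite X" using X finite_subset by blast
  define g where "g r i = e (of_int i * (real r / real N))" for r i
  have "complex_of_real (\<Sum>r<N. (norm (\<Sum>i\<in>X. w i * g r i))\<^sup>2)
      = (\<Sum>r<N. (\<Sum>i\<in>X. w i * g r i) * cnj (\<Sum>i\<in>X. w i * g r i))"
    unfolding of_real_sum complex_norm_square by simp
  also have "\<dots> = (\<Sum>r<N. \<Sum>i\<in>X. \<Sum>j\<in>X. w i * cnj (w j) * e (of_int (i - j) * (real r / real N)))"
  proof (intro sum.cong refl)
    fix r
    have "g r i * cnj (g r j) = e (of_int (i - j) * (real r / real N))" for i j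
      by (simp add: g_def flip: e_minus e_add) (simp add: algebra_simps diff_divide_distrib)
    then show "(\<Sum>i\<in>X. w i * g r i) * cnj (\<Sum>i\<in>X. w i * g r i)
        = (\<Sum>i\<in>X. \<Sum>j\<in>X. w i * cnj (w j) * e (of_int (i - j) * (real r / real N)))"
      by (simp add: sum_product cnj_sum mult_ac)
  qed
  also have "\<dots> = (\<Sum>i\<in>X. \<Sum>j\<in>X. w i * cnj (w j) * (\<Sum>r<N. e (of_int (i - j) * (real r / real N))))"
    by (subst sum.swap, intro sum.cong refl, subst sum.swap) (simp add: sum_distrib_left)
  also have "\<dots> = (\<Sum>i\<in>X. \<Sum>j\<in>X. w i * cnj (w j) * (if i = j then of_nat N else 0))"
  proof (intro sum.cong refl)
    fix i j assume "i \<in> X" "j \<in> X"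
    then have "i \<in> {-B..B}" "j \<in> {-B..B}" using X by auto
    then have "\<bar>i - j\<bar> < int N" using N by (auto simp: abs_if)
    from sum_e_roots[OF this]
    show "w i * cnj (w j) * (\<Sum>r<N. e (of_int (i - j) * (real r / real N)))
        = w i * cnj (w j) * (if i = j then of_nat N else 0)" by simp
  qed
  also have "\<dots> = (\<Sum>i\<in>X. w i * cnj (w i) * of_nat N)"
    using fX by (intro sum.cong refl) (simp add: if_distrib cong: if_cong)
  also have "\<dots> = complex_of_real (real N * (\<Sum>i\<in>X. (norm (w i))\<^sup>2))"
    unfolding of_real_sum of_real_mult complex_norm_square by (simp add: sum_distrib_left mult_ac)
  finally show ?thesis unfolding g_def of_real_eq_iff .
qed

text \<open>Correlation with \<open>D\<close> multiplies the transform of \<open>c\<close> by the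
  conjugate of the transform of \<open>D\<close>; Parseval on both sides gives the bound.\<close>

lemma l2_multiplier_bound:
  fixes D c :: "int \<Rightarrow> real"
  assumes J: "finite J" and C: "finite C" and I: "finite I"
    and c0: "\<And>m. m \<notin> C \<Longrightarrow> c m = 0"
    and bound: "\<And>\<gamma>. 0 \<le> \<gamma> \<Longrightarrow> \<gamma> < 1 \<Longrightarrow> norm (\<Sum>j\<in>J. of_real (D j) * e (of_int j * \<gamma>)) \<le> \<eta>"
  shows "(\<Sum>i\<in>I. (\<Sum>j\<in>J. D j * c (i + j))\<^sup>2) \<le> \<eta>\<^sup>2 * (\<Sum>m\<in>C. (c m)\<^sup>2)"
proof -
  define B where "B = Max (insert 0 (abs ` (I \<union> J \<union> C)))"
  have Bge: "\<bar>x\<bar> \<le> B" if "x \<in> I \<union> J \<union> C" for x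
    unfolding B_def using that I J C by (intro Max_ge) auto
  have B0: "B \<ge> 0" unfolding B_def using I J C by (intro Max_ge) auto
  \<comment> \<open>With \<open>J\<close> and \<open>C\<close> inside [-B, B] the correlation lives
    in [-2 B, 2 B], for which 4 B + 1 sample points suffice.\<close>
  define N where "N = nat (4 * B + 1)"
  have N: "int N = 4 * B + 1" "N > 0" using B0 by (auto simp: N_def)
  define W where "W i = (\<Sum>j\<in>J. D j * c (i + j))" for i
  define hat where "hat v r = (\<Sum>i\<in>{-(2*B)..2*B}. complex_of_real (v i) * e (of_int i * (real r / real N)))"
    for v r
  have pars: "(\<Sum>r<N. (norm (hat v r))\<^sup>2) = real N * (\<Sum>i\<in>{-(2*B)..2*B}. (v i)\<^sup>2)" for v
    unfolding hat_def using discrete_parseval[of "{-(2*B)..2*B}" "2*B" N "\<lambda>i. complex_of_real (v i)"] N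
    by simp
  \<comment> \<open>Translation becomes modulation. By |j| \<le> B the shifted window still contains
    \<open>C\<close>, so no term is lost.\<close>
  have hatc: "(\<Sum>i\<in>{-(2*B)..2*B}. complex_of_real (c (i + j)) * e (of_int i * (real r / real N)))
      = cnj (e (of_int j * (real r / real N))) * hat c r" if "j \<in> J" for j r
  proof -
    have jB: "\<bar>j\<bar> \<le> B" using Bge that by auto
    define h where "h m = complex_of_real (c m) * e (of_int (m - j) * (real r / real N))" for m
    have "(\<Sum>i\<in>{-(2*B)..2*B}. complex_of_real (c (i + j)) * e (of_int i * (real r / real N)))
       = (\<Sum>m\<in>{-(2*B)+j..2*B+j}. h m)"
      by (rule sum.reindex_bij_witness[where i="\<lambda>m. m - j" and j="\<lambda>i. i + j"]) (auto simp: h_def)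
    also have "\<dots> = (\<Sum>m\<in>C. h m)"
      using jB Bge c0 C by (intro sum.mono_neutral_right) (auto simp: h_def abs_le_iff, force+)
    also have "\<dots> = (\<Sum>m\<in>{-(2*B)..2*B}. h m)"
      using Bge c0 C B0 by (intro sum.mono_neutral_left) (auto simp: h_def abs_le_iff, force+)
    also have "\<dots> = cnj (e (of_int j * (real r / real N))) * hat c r"
      by (auto simp: h_def hat_def sum_distrib_left algebra_simps simp flip: e_minus intro!: sum.cong)
         (simp add: diff_divide_distrib flip: e_add)
    finally show ?thesis .
  qed
  have hatW: "hat W r = cnj (\<Sum>j\<in>J. of_real (D j) * e (of_int j * (real r / real N))) * hat c r" for r
  proof -
    have "hat W r = (\<Sum>j\<in>J. of_real (D j) *
        (\<Sum>i\<in>{-(2*B)..2*B}. complex_of_real (c (i + j)) * e (of_int i * (real r / real N))))"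
      unfolding hat_def W_def of_real_sum sum_distrib_right sum_distrib_left
      by (subst sum.swap) (simp add: mult_ac)
    also have "\<dots> = (\<Sum>j\<in>J. of_real (D j) * (cnj (e (of_int j * (real r / real N))) * hat c r))"
      by (intro sum.cong refl arg_cong2[where f = times] hatc)
    finally show ?thesis by (simp add: sum_distrib_left mult_ac)
  qed
  have "real N * (\<Sum>i\<in>{-(2*B)..2*B}. (W i)\<^sup>2) = (\<Sum>r<N. (norm (hat W r))\<^sup>2)"
    by (simp add: pars)
  also have "\<dots> \<le> (\<Sum>r<N. \<eta>\<^sup>2 * (norm (hat c r))\<^sup>2)"
  proof (intro sum_mono)
    fix r assume "r \<in> {..<N}"
    then have "norm (\<Sum>j\<in>J. of_real (D j) * e (of_int j * (real r / real N))) \<le> \<eta>"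
      by (intro bound) auto
    then have "norm (hat W r) \<le> \<eta> * norm (hat c r)"
      unfolding hatW norm_mult complex_mod_cnj by (rule mult_right_mono) auto
    then show "(norm (hat W r))\<^sup>2 \<le> \<eta>\<^sup>2 * (norm (hat c r))\<^sup>2"
      unfolding power_mult_distrib[symmetric] by (rule power_mono) auto
  qed
  also have "\<dots> = real N * (\<eta>\<^sup>2 * (\<Sum>i\<in>{-(2*B)..2*B}. (c i)\<^sup>2))"
    by (simp add: pars flip: sum_distrib_left)
  finally have "(\<Sum>i\<in>{-(2*B)..2*B}. (W i)\<^sup>2) \<le> \<eta>\<^sup>2 * (\<Sum>i\<in>{-(2*B)..2*B}. (c i)\<^sup>2)"
    using N by simp
  moreover have "(\<Sum>i\<in>I. (W i)\<^sup>2) \<le> (\<Sum>i\<in>{-(2*B)..2*B}. (W i)\<^sup>2)"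
    using Bge B0 by (intro sum_mono2) (auto simp: abs_le_iff, force+)
  moreover have "(\<Sum>m\<in>C. (c m)\<^sup>2) = (\<Sum>m\<in>{-(2*B)..2*B}. (c m)\<^sup>2)"
    using Bge c0 C B0 by (intro sum.mono_neutral_left) (auto simp: abs_le_iff, force+)
  ultimately show ?thesis by (simp add: W_def)
qed

text \<open>Summation by parts: the difference moves from \<open>c\<close> to the weights, and the
  differenced weights have transform -(1 - e(\<gamma>)) times that of \<open>w\<close>.\<close>

lemma l2_difference_bound:
  fixes w c :: "int \<Rightarrow> real"
  assumes C: "finite C" and I: "finite I"
    and w0: "\<And>j. j \<notin> {-R..R} \<Longrightarrow> w j = 0"
    and c0: "\<And>m. m \<notin> C \<Longrightarrow> c m = 0"
    and bound: "\<And>\<gamma>. 0 \<le> \<gamma> \<Longrightarrow> \<gamma> < 1 \<Longrightarrow>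
       norm ((1 - e \<gamma>) * (\<Sum>j\<in>{-R..R}. of_real (w j) * e (of_int j * \<gamma>))) \<le> \<eta>"
  shows "(\<Sum>i\<in>I. (\<Sum>j\<in>{-R..R}. w j * (c (i + j + 1) - c (i + j)))\<^sup>2) \<le> \<eta>\<^sup>2 * (\<Sum>m\<in>C. (c m)\<^sup>2)"
proof -
  define D where "D j = w (j - 1) - w j" for j
  \<comment> \<open>The map \<open>\<kappa>\<close> lets one computation serve twice, as identity
    for the real sums and as \<open>complex_of_real\<close> for the transform. The range extends to
    R + 1 because the differenced weights reach that far.\<close>
  have shift: "(\<Sum>j\<in>{-R..R+1}. (\<kappa> (w (j - 1)) - \<kappa> (w j)) * h j)
      = (\<Sum>j\<in>{-R..R}. \<kappa> (w j) * (h (j + 1) - h j))" if "\<kappa> 0 = 0"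
    for h :: "int \<Rightarrow> 'b :: comm_ring" and \<kappa> :: "real \<Rightarrow> 'b"
  proof -
    have "(\<Sum>j\<in>{-R..R+1}. \<kappa> (w (j - 1)) * h j) = (\<Sum>j\<in>{-R+1..R+1}. \<kappa> (w (j - 1)) * h j)"
      using w0 that by (intro sum.mono_neutral_right) auto
    also have "\<dots> = (\<Sum>j\<in>{-R..R}. \<kappa> (w j) * h (j + 1))"
      by (rule sum.reindex_bij_witness[where i="\<lambda>m. m + 1" and j="\<lambda>i. i - 1"]) auto
    finally have 1: "(\<Sum>j\<in>{-R..R+1}. \<kappa> (w (j - 1)) * h j) = (\<Sum>j\<in>{-R..R}. \<kappa> (w j) * h (j + 1))" .
    have 2: "(\<Sum>j\<in>{-R..R+1}. \<kappa> (w j) * h j) = (\<Sum>j\<in>{-R..R}. \<kappa> (w j) * h j)"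
      using w0 that by (intro sum.mono_neutral_right) auto
    show ?thesis using 1 2 by (simp add: algebra_simps sum_subtractf sum.distrib)
  qed
  have "(\<Sum>i\<in>I. (\<Sum>j\<in>{-R..R+1}. D j * c (i + j))\<^sup>2) \<le> \<eta>\<^sup>2 * (\<Sum>m\<in>C. (c m)\<^sup>2)"
  proof (rule l2_multiplier_bound[OF _ C I c0])
    fix \<gamma> :: real assume "0 \<le> \<gamma>" "\<gamma> < 1"
    have "(\<Sum>j\<in>{-R..R+1}. of_real (D j) * e (of_int j * \<gamma>))
        = (\<Sum>j\<in>{-R..R}. complex_of_real (w j) * (e (of_int (j + 1) * \<gamma>) - e (of_int j * \<gamma>)))"
      using shift[of complex_of_real "\<lambda>j. e (of_int j * \<gamma>)"] by (simp add: D_def)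
    also have "\<dots> = - ((1 - e \<gamma>) * (\<Sum>j\<in>{-R..R}. of_real (w j) * e (of_int j * \<gamma>)))"
      by (simp add: sum_distrib_left algebra_simps e_add flip: sum_negf)
    finally show "norm (\<Sum>j\<in>{-R..R+1}. of_real (D j) * e (of_int j * \<gamma>)) \<le> \<eta>"
      using bound[OF \<open>0 \<le> \<gamma>\<close> \<open>\<gamma> < 1\<close>] by (simp only: norm_minus_cancel)
  qed auto
  moreover have "(\<Sum>j\<in>{-R..R+1}. D j * c (i + j)) = (\<Sum>j\<in>{-R..R}. w j * (c (i + j + 1) - c (i + j)))" for i
    using shift[of "\<lambda>x. x" "\<lambda>j. c (i + j)"] by (simp add: D_def add.assoc)
  ultimately show ?thesis by simp
qed

section \<open>Dyadic stopping intervals on the integers\<close>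

definition dyadic_block :: "nat \<Rightarrow> int \<Rightarrow> int set" where
  "dyadic_block s i = {2 ^ s * (i div 2 ^ s)..<2 ^ s * (i div 2 ^ s) + 2 ^ s}"

text \<open>Blocks of one scale become the classes of an equivalence relation, so that symmetry and
  nesting are facts about integer division.\<close>

lemma mem_dyadic_block_iff: "j \<in> dyadic_block s i \<longleftrightarrow> j div 2 ^ s = i div 2 ^ s"
proof -
  define p where "p = (2::int) ^ s"
  have p: "p > 0" by (simp add: p_def)
  have "j div p = q \<longleftrightarrow> p * q \<le> j \<and> j < p * q + p" for q
  proof
    assume q: "j div p = q"
    have "p * (j div p) \<le> j" "j < p * (j div p) + p"
      using pos_mod_sign[OF p, of j] pos_mod_bound[OF p, of j] mult_div_mod_eq[of p j] by linarith+
    then show "p * q \<le> j \<and> j < p * q + p" using q by simp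
  next
    assume "p * q \<le> j \<and> j < p * q + p"
    then show "j div p = q"
      by (intro int_div_pos_eq[of _ _ _ "j - p * q"]) auto
  qed
  then show ?thesis by (simp add: dyadic_block_def p_def)
qed

lemma finite_dyadic_block [simp]: "finite (dyadic_block s i)"
  by (simp add: dyadic_block_def)

lemma card_dyadic_block [simp]: "card (dyadic_block s i) = 2 ^ s"
  by (simp add: dyadic_block_def nat_power_eq)

lemma self_mem_dyadic_block [simp]: "i \<in> dyadic_block s i"
  by (simp add: mem_dyadic_block_iff)

lemma dyadic_block_eq: "j \<in> dyadic_block s i \<Longrightarrow> dyadic_block s j = dyadic_block s i"
  by (auto simp: mem_dyadic_block_iff)

lemma dyadic_block_sym: "j \<in> dyadic_block s i \<longleftrightarrow> i \<in> dyadic_block s j"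
  by (auto simp: mem_dyadic_block_iff)

lemma dyadic_block_mono: "s \<le> t \<Longrightarrow> dyadic_block s i \<subseteq> dyadic_block t i"
proof
  fix j assume st: "s \<le> t" and j: "j \<in> dyadic_block s i"
  have "x div 2 ^ t = x div 2 ^ s div 2 ^ (t - s)" for x :: int
  proof -
    have "(2::int) ^ t = 2 ^ s * 2 ^ (t - s)" using st by (simp flip: power_add)
    then show ?thesis by (simp add: zdiv_zmult2_eq)
  qed
  then show "j \<in> dyadic_block t i" using j by (simp add: mem_dyadic_block_iff)
qed

lemma dyadic_block_0 [simp]: "dyadic_block 0 i = {i}"
  by (auto simp: mem_dyadic_block_iff)

text \<open>The source of the threefold enlargements: a block and its two neighbours cover
  everything within one block length.\<close>

lemma dyadic_block_nearby:
  assumes "\<bar>i - j\<bar> \<le> 2 ^ s"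
  shows "i \<in> dyadic_block s j \<or> i + 2 ^ s \<in> dyadic_block s j \<or> i - 2 ^ s \<in> dyadic_block s j"
  using assms self_mem_dyadic_block[of j s] unfolding dyadic_block_def by (auto simp: abs_le_iff)

locale dyadic_stopping =
  fixes F :: "int \<Rightarrow> real" and X :: "int set" and \<alpha> :: real
  assumes finite_X: "finite X" and F_outside: "\<And>i. i \<notin> X \<Longrightarrow> F i = 0"
    and F_nonneg: "\<And>i. F i \<ge> 0" and \<alpha>_pos: "\<alpha> > 0"
begin

definition block_sum :: "nat \<Rightarrow> int \<Rightarrow> real" where
  "block_sum s i = (\<Sum>j\<in>dyadic_block s i. F j)"

definition heavy :: "nat \<Rightarrow> int \<Rightarrow> bool" where
  "heavy s i \<longleftrightarrow> \<alpha> * 2 ^ s < block_sum s i"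

text \<open>Maximal intervals are not stored as objects. Each point is filed under the largest scale
  at which its block is heavy, so \<open>selected s\<close> is the union of the stopping intervals
  of length \<open>2 ^ s\<close>.\<close>

definition selected :: "nat \<Rightarrow> int set" where
  "selected s = {i. heavy s i \<and> (\<forall>t>s. \<not> heavy t i)}"

abbreviation total :: real where "total \<equiv> (\<Sum>i\<in>X. F i)"

lemma sum_F_le_total: "finite Y \<Longrightarrow> (\<Sum>i\<in>Y. F i) \<le> total"
proof -
  assume Y: "finite Y"
  have "(\<Sum>i\<in>Y. F i) = (\<Sum>i\<in>Y \<inter> X. F i)"
    using Y F_outside by (intro sum.mono_neutral_right) auto
  also have "\<dots> \<le> total" using finite_X F_nonneg by (intro sum_mono2) auto
  finally show ?thesis .
qed

lemma total_nonneg: "total \<ge> 0" using F_nonneg by (simp add: sum_nonneg)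

lemma block_sum_nonneg: "block_sum s i \<ge> 0"
  using F_nonneg by (simp add: block_sum_def sum_nonneg)

lemma block_sum_eq: "j \<in> dyadic_block s i \<Longrightarrow> block_sum s j = block_sum s i"
  by (simp add: block_sum_def dyadic_block_eq)

text \<open>A heavy block of scale s has mass above \<alpha> 2^s, which the finite total allows only
  for small s. This is what makes a largest heavy scale exist.\<close>

lemma heavy_bounded: "\<exists>S. \<forall>s i. heavy s i \<longrightarrow> s < S"
proof -
  obtain S :: nat where S: "total / \<alpha> < real S" using reals_Archimedean2 by blast
  have "s < S" if "heavy s i" for s i
  proof -
    have "\<alpha> * real s \<le> \<alpha> * 2 ^ s" using \<alpha>_pos of_nat_less_two_power[of s, where 'a=real] by simp
    also have "\<dots> < block_sum s i" using that by (simp add: heavy_def)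
    also have "\<dots> \<le> total" by (simp add: block_sum_def sum_F_le_total)
    finally have "real s < total / \<alpha>" using \<alpha>_pos by (simp add: field_simps)
    then show "s < S" using S by linarith
  qed
  then show ?thesis by blast
qed

lemma heavy_imp_selected:
  assumes "heavy s i" obtains t where "i \<in> selected t"
proof -
  obtain S where S: "\<And>s i. heavy s i \<Longrightarrow> s < S" using heavy_bounded by blast
  have "heavy (GREATEST s. heavy s i) i"
    using assms S by (intro GreatestI_nat[of "\<lambda>s. heavy s i" s S]) (auto intro: less_imp_le)
  moreover have "\<not> heavy t i" if "t > (GREATEST s. heavy s i)" for t
    using Greatest_le_nat[of "\<lambda>s. heavy s i" t S] S that by (auto intro: less_imp_le)
  ultimately show thesis using that by (auto simp: selected_def)
qed

lemma selected_unique: "i \<in> selected s \<Longrightarrow> i \<in> selected t \<Longrightarrow> s = t"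
  unfolding selected_def by (metis (mono_tags, lifting) linorder_neqE_nat mem_Collect_eq)

text \<open>From scale s on, i and j have the same blocks, hence the same heavy ones.\<close>

lemma selected_saturated:
  assumes "i \<in> selected s" "j \<in> dyadic_block s i"
  shows "j \<in> selected s"
proof -
  have "heavy t j \<longleftrightarrow> heavy t i" if "t \<ge> s" for t
    using that assms(2) dyadic_block_mono[of s t i] block_sum_eq[of j t i] by (auto simp: heavy_def)
  then show ?thesis using assms(1) by (auto simp: selected_def)
qed

lemma finite_selected: "finite (selected s)"
proof (rule finite_subset)
  show "selected s \<subseteq> (\<Union>j\<in>X. dyadic_block s j)"
  proof
    fix i assume "i \<in> selected s"
    then have "\<alpha> * 2 ^ s < block_sum s i" by (simp add: selected_def heavy_def)
    moreover have "0 < \<alpha> * 2 ^ s" using \<alpha>_pos by simp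
    ultimately have "block_sum s i > 0" by linarith
    then have "\<exists>j\<in>dyadic_block s i. F j \<noteq> 0"
      unfolding block_sum_def by (metis less_irrefl sum.neutral)
    then show "i \<in> (\<Union>j\<in>X. dyadic_block s j)" using F_outside dyadic_block_sym by blast
  qed
qed (simp add: finite_X)

lemma F_le_if_not_selected:
  assumes "\<And>s. i \<notin> selected s" shows "F i \<le> \<alpha>"
proof (rule ccontr)
  assume "\<not> F i \<le> \<alpha>"
  \<comment> \<open>The block of scale 0 is the point itself, so a large value is already a heavy
    block.\<close>
  then have "heavy 0 i" by (simp add: heavy_def block_sum_def)
  then show False using assms heavy_imp_selected by blast
qed

text \<open>The factor 2 comes from the parent block, which is twice as long and, by maximality, not
  heavy.\<close>

lemma block_sum_selected_le:
  assumes "i \<in> selected s" shows "block_sum s i \<le> 2 * \<alpha> * 2 ^ s"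
proof -
  have "block_sum s i \<le> block_sum (Suc s) i"
    unfolding block_sum_def using F_nonneg by (intro sum_mono2 dyadic_block_mono) auto
  also have "\<dots> \<le> \<alpha> * 2 ^ Suc s" using assms by (auto simp: selected_def heavy_def not_less)
  finally show ?thesis by simp
qed

text \<open>Double counting of the pairs of points in a common block, which lies entirely inside
  \<open>selected s\<close>.\<close>

lemma sum_block_average: "(\<Sum>i\<in>selected s. block_sum s i / 2 ^ s) = (\<Sum>i\<in>selected s. F i)"
proof -
  have "(\<Sum>i\<in>selected s. block_sum s i) = (\<Sum>i\<in>selected s. \<Sum>j\<in>selected s. if j \<in> dyadic_block s i then F j else 0)"
  proof (intro sum.cong refl)
    fix i assume i: "i \<in> selected s"
    have "dyadic_block s i \<subseteq> selected s" using selected_saturated i by blast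
    then have "selected s \<inter> dyadic_block s i = dyadic_block s i" by blast
    then show "block_sum s i = (\<Sum>j\<in>selected s. if j \<in> dyadic_block s i then F j else 0)"
      using finite_selected by (simp add: block_sum_def flip: sum.inter_restrict)
  qed
  also have "\<dots> = (\<Sum>j\<in>selected s. \<Sum>i\<in>selected s. if i \<in> dyadic_block s j then F j else 0)"
    by (subst sum.swap) (simp add: dyadic_block_sym)
  also have "\<dots> = (\<Sum>j\<in>selected s. 2 ^ s * F j)"
  proof (intro sum.cong refl)
    fix j assume j: "j \<in> selected s"
    have "dyadic_block s j \<subseteq> selected s" using selected_saturated j by blast
    then have "selected s \<inter> dyadic_block s j = dyadic_block s j" by blast
    then show "(\<Sum>i\<in>selected s. if i \<in> dyadic_block s j then F j else 0) = 2 ^ s * F j"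
      using finite_selected by (simp flip: sum.inter_restrict)
  qed
  finally show ?thesis by (simp flip: sum_divide_distrib sum_distrib_left)
qed

lemma sum_selected_le_total:
  assumes "finite S" shows "(\<Sum>s\<in>S. \<Sum>i\<in>selected s. F i) \<le> total"
proof -
  have "(\<Sum>s\<in>S. \<Sum>i\<in>selected s. F i) = (\<Sum>i\<in>(\<Union>s\<in>S. selected s). F i)"
    using assms finite_selected selected_unique by (intro sum.UNION_disjoint[symmetric]) auto
  also have "\<dots> \<le> total" using assms finite_selected by (intro sum_F_le_total) auto
  finally show ?thesis .
qed

lemma card_selected_le: "\<alpha> * real (card (selected s)) \<le> (\<Sum>i\<in>selected s. F i)"
proof -
  have "\<alpha> * real (card (selected s)) = (\<Sum>i\<in>selected s. \<alpha>)" by simp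
  also have "\<dots> \<le> (\<Sum>i\<in>selected s. block_sum s i / 2 ^ s)"
    by (intro sum_mono) (simp add: selected_def heavy_def pos_le_divide_eq less_imp_le)
  finally show ?thesis by (simp only: sum_block_average)
qed

definition near_selected :: "int set" where
  "near_selected = {i. \<exists>s. \<exists>j\<in>selected s. \<bar>i - j\<bar> \<le> 2 ^ s}"

lemma near_selected_card: "finite near_selected" "\<alpha> * real (card near_selected) \<le> 3 * total"
proof -
  obtain S where S: "\<And>s i. heavy s i \<Longrightarrow> s < S" using heavy_bounded by blast
  \<comment> \<open>Each selected set and its two translates by a block length cover the nearby
    points; hence the 3 in the bound.\<close>
  define V where "V s = selected s \<union> (\<lambda>i. i - 2 ^ s) ` selected s \<union> (\<lambda>i. i + 2 ^ s) ` selected s" for s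
  have sub: "near_selected \<subseteq> (\<Union>s<S. V s)"
  proof
    fix i assume "i \<in> near_selected"
    then obtain s j where j: "j \<in> selected s" "\<bar>i - j\<bar> \<le> 2 ^ s" by (auto simp: near_selected_def)
    have "dyadic_block s j \<subseteq> selected s" using selected_saturated j(1) by blast
    then have "i \<in> V s" using dyadic_block_nearby[OF j(2)] unfolding V_def by force
    moreover have "s < S" using S j(1) by (auto simp: selected_def)
    ultimately show "i \<in> (\<Union>s<S. V s)" by blast
  qed
  have fV: "finite (V s)" for s by (simp add: V_def finite_selected)
  show "finite near_selected" by (rule finite_subset[OF sub]) (simp add: fV)
  have "card near_selected \<le> card (\<Union>s<S. V s)" by (intro card_mono sub) (simp add: fV)
  also have "\<dots> \<le> (\<Sum>s<S. card (V s))" by (rule card_UN_le) simp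
  also have "\<dots> \<le> (\<Sum>s<S. 3 * card (selected s))"
  proof (rule sum_mono)
    fix s
    have "card (V s) \<le> card (selected s \<union> (\<lambda>i. i - 2 ^ s) ` selected s) + card ((\<lambda>i. i + 2 ^ s) ` selected s)"
      unfolding V_def by (rule card_Un_le)
    also have "\<dots> \<le> card (selected s) + card ((\<lambda>i. i - 2 ^ s) ` selected s) + card ((\<lambda>i. i + 2 ^ s) ` selected s)"
      by (intro add_right_mono card_Un_le)
    also have "\<dots> \<le> card (selected s) + card (selected s) + card (selected s)"
      by (intro add_mono card_image_le finite_selected order_refl)
    finally show "card (V s) \<le> 3 * card (selected s)" by simp
  qed
  finally have "real (card near_selected) \<le> (\<Sum>s<S. 3 * real (card (selected s)))"
    by (metis (mono_tags, lifting) of_nat_le_iff of_nat_mult of_nat_numeral of_nat_sum sum.cong)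
  then have "\<alpha> * real (card near_selected) \<le> \<alpha> * (\<Sum>s<S. 3 * real (card (selected s)))"
    using \<alpha>_pos by (intro mult_left_mono) auto
  also have "\<dots> = 3 * (\<Sum>s<S. \<alpha> * real (card (selected s)))"
    by (simp add: sum_distrib_left mult_ac)
  also have "\<dots> \<le> 3 * (\<Sum>s<S. \<Sum>i\<in>selected s. F i)"
    by (intro mult_left_mono sum_mono card_selected_le) auto
  also have "\<dots> \<le> 3 * total" using sum_selected_le_total[of "{..<S}"] by simp
  finally show "\<alpha> * real (card near_selected) \<le> 3 * total" .
qed

section \<open>The cancelling part of the short stopping intervals and its primitive\<close>

definition fluctuation :: "nat \<Rightarrow> int \<Rightarrow> real" where
  "fluctuation a i = (\<Sum>s\<le>a. if i \<in> selected s then F i - block_sum s i / 2 ^ s else 0)"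

text \<open>Partial sums that restart from 0 at the left end of every block. The strict
  \<open>j < i\<close> makes the forward difference at i return the fluctuation at i itself.\<close>

definition primitive :: "nat \<Rightarrow> int \<Rightarrow> real" where
  "primitive a i = (\<Sum>s\<le>a. if i \<in> selected s
     then \<Sum>j\<in>{j\<in>dyadic_block s i. j < i}. F j - block_sum s i / 2 ^ s else 0)"

text \<open>Inside a block one more summand enters. If i is the last point of its block, mean zero
  brings the partial sum back to 0, where the next block starts as well.\<close>

lemma fluctuation_eq_difference: "fluctuation a i = primitive a (i + 1) - primitive a i"
proof -
  have "(if i \<in> selected s then F i - block_sum s i / 2 ^ s else 0)
    = (if i + 1 \<in> selected s
        then \<Sum>j\<in>{j\<in>dyadic_block s (i + 1). j < i + 1}. F j - block_sum s (i + 1) / 2 ^ s else 0)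
    - (if i \<in> selected s then \<Sum>j\<in>{j\<in>dyadic_block s i. j < i}. F j - block_sum s i / 2 ^ s else 0)"
    for s
  proof (cases "i + 1 \<in> dyadic_block s i")
    case True
    have 1: "i + 1 \<in> selected s \<longleftrightarrow> i \<in> selected s"
      using True selected_saturated dyadic_block_sym by blast
    have 2: "{j\<in>dyadic_block s (i + 1). j < i + 1} = insert i {j\<in>dyadic_block s i. j < i}"
      unfolding dyadic_block_eq[OF True] using self_mem_dyadic_block[of i s]
      by (intro set_eqI) (auto simp: zless_add1_eq)
    have "finite {j\<in>dyadic_block s i. j < i}" by simp
    then show ?thesis unfolding 1 2 block_sum_eq[OF True]
      by (subst sum.insert) auto
  next
    case False
    have "i \<in> dyadic_block s i" by simp
    then have 1: "j \<le> i" if "j \<in> dyadic_block s i" for j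
      using that False unfolding dyadic_block_def by auto
    have "\<not> j < i + 1" if "j \<in> dyadic_block s (i + 1)" for j
    proof
      assume "j < i + 1"
      moreover have "i + 1 \<in> dyadic_block s (i + 1)" by simp
      ultimately have "i \<in> dyadic_block s (i + 1)" using that unfolding dyadic_block_def by auto
      then show False using False dyadic_block_sym by blast
    qed
    then have 2: "{j\<in>dyadic_block s (i + 1). j < i + 1} = {}" by auto
    have "dyadic_block s i = insert i {j\<in>dyadic_block s i. j < i}" using 1 by force
    moreover have "(\<Sum>j\<in>dyadic_block s i. F j - block_sum s i / 2 ^ s) = 0"
      by (simp add: sum_subtractf flip: block_sum_def)
    ultimately have "(\<Sum>j\<in>insert i {j\<in>dyadic_block s i. j < i}. F j - block_sum s i / 2 ^ s) = 0"
      by simp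
    then have "F i - block_sum s i / 2 ^ s
        = - (\<Sum>j\<in>{j\<in>dyadic_block s i. j < i}. F j - block_sum s i / 2 ^ s)"
      by (subst (asm) sum.insert) auto
    then show ?thesis unfolding 2 by simp
  qed
  then show ?thesis unfolding fluctuation_def primitive_def by (simp flip: sum_subtractf)
qed

lemma primitive_outside: "i \<notin> (\<Union>s\<le>a. selected s) \<Longrightarrow> primitive a i = 0"
  by (auto simp: primitive_def intro!: sum.neutral)

text \<open>The partial sum of \<open>F\<close> and the matching multiple of the average both lie
  between 0 and the block sum.\<close>

lemma primitive_selected:
  assumes "i \<in> selected s" "s \<le> a" shows "\<bar>primitive a i\<bar> \<le> block_sum s i"
proof -
  define P where "P = {j\<in>dyadic_block s i. j < i}"
  have P: "P \<subseteq> dyadic_block s i" "finite P" by (auto simp: P_def)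
  have "primitive a i = (\<Sum>t\<le>a. if t = s then \<Sum>j\<in>P. F j - block_sum s i / 2 ^ s else 0)"
    unfolding primitive_def P_def using assms selected_unique by (intro sum.cong refl) auto
  also have "\<dots> = (\<Sum>j\<in>P. F j) - real (card P) * (block_sum s i / 2 ^ s)"
    using assms(2) by (simp add: sum_subtractf)
  finally have eq: "primitive a i = (\<Sum>j\<in>P. F j) - real (card P) * (block_sum s i / 2 ^ s)" .
  have "card P \<le> card (dyadic_block s i)" using P by (intro card_mono) auto
  then have "real (card P) \<le> real (2 ^ s)" by (simp only: of_nat_le_iff card_dyadic_block)
  then have "real (card P) * (block_sum s i / 2 ^ s) \<le> 2 ^ s * (block_sum s i / 2 ^ s)"
    using block_sum_nonneg by (intro mult_right_mono) auto
  then have 1: "real (card P) * (block_sum s i / 2 ^ s) \<le> block_sum s i" by simp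
  have 2: "(\<Sum>j\<in>P. F j) \<le> block_sum s i"
    unfolding block_sum_def using P F_nonneg by (intro sum_mono2) auto
  have 3: "(\<Sum>j\<in>P. F j) \<ge> 0" using F_nonneg by (simp add: sum_nonneg)
  have 4: "real (card P) * (block_sum s i / 2 ^ s) \<ge> 0" using block_sum_nonneg by simp
  show ?thesis unfolding eq using 1 2 3 4 by linarith
qed

text \<open>One factor of the square is at most 2 \<alpha> 2^s by the stopping rule; the other is
  2^s times a block average, and averages sum to the mass of \<open>F\<close>. The resulting (2^a)^2
  is what the smallness of the transform cancels.\<close>

lemma sum_primitive_squared_le:
  "(\<Sum>i\<in>(\<Union>s\<le>a. selected s). (primitive a i)\<^sup>2) \<le> 2 * \<alpha> * (2 ^ a)\<^sup>2 * total"
proof -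
  have "(\<Sum>i\<in>(\<Union>s\<le>a. selected s). (primitive a i)\<^sup>2) = (\<Sum>s\<le>a. \<Sum>i\<in>selected s. (primitive a i)\<^sup>2)"
    using finite_selected selected_unique by (intro sum.UNION_disjoint) auto
  also have "\<dots> \<le> (\<Sum>s\<le>a. \<Sum>i\<in>selected s. 2 * \<alpha> * (2 ^ a)\<^sup>2 * (block_sum s i / 2 ^ s))"
  proof (intro sum_mono)
    fix s i assume s: "s \<in> {..a}" and i: "i \<in> selected s"
    have "(primitive a i)\<^sup>2 \<le> (block_sum s i)\<^sup>2"
      using primitive_selected[OF i] s block_sum_nonneg by (simp add: abs_le_square_iff[symmetric])
    also have "\<dots> \<le> 2 * \<alpha> * 2 ^ s * block_sum s i"
      using block_sum_selected_le[OF i] block_sum_nonneg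
      by (simp add: power2_eq_square mult_right_mono)
    also have "\<dots> = 2 * \<alpha> * (2 ^ s)\<^sup>2 * (block_sum s i / 2 ^ s)" by (simp add: power2_eq_square)
    also have "\<dots> \<le> 2 * \<alpha> * (2 ^ a)\<^sup>2 * (block_sum s i / 2 ^ s)"
      using s \<alpha>_pos block_sum_nonneg
      by (intro mult_right_mono mult_left_mono power_mono power_increasing) auto
    finally show "(primitive a i)\<^sup>2 \<le> 2 * \<alpha> * (2 ^ a)\<^sup>2 * (block_sum s i / 2 ^ s)" .
  qed
  also have "\<dots> = 2 * \<alpha> * (2 ^ a)\<^sup>2 * (\<Sum>s\<le>a. \<Sum>i\<in>selected s. F i)"
    by (simp only: sum_distrib_left[symmetric] sum_block_average)
  also have "\<dots> \<le> 2 * \<alpha> * (2 ^ a)\<^sup>2 * total"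
    using \<alpha>_pos sum_selected_le_total by (intro mult_left_mono) auto
  finally show ?thesis .
qed

text \<open>No average is subtracted: intermediate lengths are estimated in l1, without
  cancellation.\<close>

definition middle :: "nat \<Rightarrow> nat \<Rightarrow> int \<Rightarrow> real" where
  "middle a a' i = (if \<exists>s. a < s \<and> s \<le> a' \<and> i \<in> selected s then F i else 0)"

lemma sum_middle_le:
  assumes "finite Y"
  shows "(\<Sum>i\<in>Y. middle a a' i) \<le> (\<Sum>s\<in>{a<..a'}. \<Sum>i\<in>selected s. F i)"
proof -
  define U where "U = (\<Union>s\<in>{a<..a'}. selected s)"
  have U: "finite U" by (simp add: U_def finite_selected)
  have "(\<Sum>i\<in>Y. middle a a' i) = (\<Sum>i\<in>Y \<inter> U. F i)"
    using assms by (intro sum.mono_neutral_cong_right) (auto simp: middle_def U_def)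
  also have "\<dots> \<le> (\<Sum>i\<in>U. F i)" using U F_nonneg by (intro sum_mono2) auto
  also have "\<dots> = (\<Sum>s\<in>{a<..a'}. \<Sum>i\<in>selected s. F i)"
    unfolding U_def using finite_selected selected_unique by (intro sum.UNION_disjoint) auto
  finally show ?thesis .
qed

text \<open>An upper bound suffices since \<open>F\<close> and the weights are nonnegative. The term
  2 \<alpha> covers \<open>F\<close> off the stopping intervals and the block average on the short
  ones.\<close>

lemma F_le_pieces:
  assumes "\<And>s. s > a' \<Longrightarrow> i \<notin> selected s"
  shows "F i \<le> 2 * \<alpha> + fluctuation a i + middle a a' i"
proof (cases "\<exists>s. i \<in> selected s")
  case False
  then have "F i \<le> \<alpha>" "fluctuation a i = 0" "middle a a' i = 0"
    using F_le_if_not_selected by (auto simp: fluctuation_def middle_def)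
  then show ?thesis using \<alpha>_pos by simp
next
  case True
  then obtain s where s: "i \<in> selected s" by blast
  have sa': "s \<le> a'" using assms s by (meson not_le)
  have "fluctuation a i = (\<Sum>t\<le>a. if t = s then F i - block_sum s i / 2 ^ s else 0)"
    unfolding fluctuation_def using s selected_unique by (intro sum.cong refl) auto
  also have "\<dots> = (if s \<le> a then F i - block_sum s i / 2 ^ s else 0)" by simp
  finally have fl: "fluctuation a i = (if s \<le> a then F i - block_sum s i / 2 ^ s else 0)" .
  show ?thesis
  proof (cases "s \<le> a")
    case True
    have "block_sum s i / 2 ^ s \<le> 2 * \<alpha>" using block_sum_selected_le[OF s] by (simp add: field_simps)
    moreover have "middle a a' i \<ge> 0" using F_nonneg by (simp add: middle_def)
    ultimately show ?thesis using fl True by simp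
  next
    case False
    then have "middle a a' i = F i" using s sa' by (auto simp: middle_def)
    then show ?thesis using False fl \<alpha>_pos by simp
  qed
qed

end

section \<open>The maximal inequality\<close>

lemma card_gt_le_sum:
  fixes g :: "'b \<Rightarrow> real"
  assumes "finite I" "\<And>i. i \<in> I \<Longrightarrow> g i \<ge> 0"
  shows "t * real (card {i\<in>I. t < g i}) \<le> (\<Sum>i\<in>I. g i)"
proof -
  have "t * real (card {i\<in>I. t < g i}) = (\<Sum>i\<in>{i\<in>I. t < g i}. t)" by simp
  also have "\<dots> \<le> (\<Sum>i\<in>{i\<in>I. t < g i}. g i)" by (intro sum_mono) auto
  also have "\<dots> \<le> (\<Sum>i\<in>I. g i)" using assms by (intro sum_mono2) auto
  finally show ?thesis .
qed

text \<open>Abstract form of the truncated measures. The transform is measured against the radius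
  \<open>2 ^ A k\<close> fixed before the k-th measure, the support against
  \<open>2 ^ A (Suc k)\<close> fixed after it. Truncation loses mass, so the masses are at most 1
  and only tend to 1.\<close>

locale lacunary_weights =
  fixes w :: "nat \<Rightarrow> int \<Rightarrow> real" and A :: "nat \<Rightarrow> nat"
  assumes strict_mono_A: "strict_mono A"
    and w_nonneg: "w k j \<ge> 0"
    and w_support: "j \<notin> {- (2 ^ A (Suc k))..2 ^ A (Suc k)} \<Longrightarrow> w k j = 0"
    and w_sum_le: "(\<Sum>j\<in>{- (2 ^ A (Suc k))..2 ^ A (Suc k)}. w k j) \<le> 1"
    and w_mass: "(\<lambda>k. \<Sum>j\<in>{- (2 ^ A (Suc k))..2 ^ A (Suc k)}. w k j) \<longlonglongrightarrow> 1"
    and w_hat: "0 \<le> \<gamma> \<Longrightarrow> \<gamma> < 1 \<Longrightarrow>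
       norm ((1 - e \<gamma>) * (\<Sum>j\<in>{- (2 ^ A (Suc k))..2 ^ A (Suc k)}. of_real (w k j) * e (of_int j * \<gamma>)))
         \<le> 1 / (2 ^ k * 2 ^ A k)"
begin

abbreviation window :: "nat \<Rightarrow> int set" where
  "window k \<equiv> {- (2 ^ A (Suc k))..2 ^ A (Suc k)}"

text \<open>The weak type bound, with \<open>I\<close> a finite set of points where the maximal
  function exceeds 4 \<alpha>. That height splits into the 2 \<alpha> of \<open>F_le_pieces\<close>
  and one \<alpha> for each of the two other pieces.\<close>

lemma discrete_maximal_inequality:
  assumes X: "finite X" and F0: "\<And>i. i \<notin> X \<Longrightarrow> F i = 0" and Fnn: "\<And>i. F i \<ge> 0"
    and \<alpha>: "\<alpha> > 0" and I: "finite I"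
    and large: "\<And>i. i \<in> I \<Longrightarrow> \<exists>k<K. 4 * \<alpha> < (\<Sum>j\<in>window k. w k j * F (i + j))"
  shows "\<alpha> * real (card I) \<le> 8 * (\<Sum>i\<in>X. F i)"
proof -
  interpret dyadic_stopping F X \<alpha> using X F0 Fnn \<alpha> by unfold_locales auto
  define fl where "fl k i = (\<Sum>j\<in>window k. w k j * fluctuation (A k) (i + j))" for k i
  define md where "md k i = (\<Sum>j\<in>window k. w k j * middle (A k) (A (Suc k)) (i + j))" for k i
  have middle_nonneg: "middle a a' i \<ge> 0" for a a' i using Fnn by (simp add: middle_def)
  have md_nonneg: "md k i \<ge> 0" for k i
    unfolding md_def by (intro sum_nonneg mult_nonneg_nonneg w_nonneg middle_nonneg)
  \<comment> \<open>Written with squares so that Chebyshev can use the l2 bound.\<close>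
  define E2 where "E2 k = {i\<in>I. \<alpha>\<^sup>2 < (fl k i)\<^sup>2}" for k
  define E3 where "E3 k = {i\<in>I. \<alpha> < md k i}" for k
  have cover: "I \<subseteq> near_selected \<union> (\<Union>k<K. E2 k \<union> E3 k)"
  proof
    fix i assume i: "i \<in> I"
    then obtain k where k: "k < K" "4 * \<alpha> < (\<Sum>j\<in>window k. w k j * F (i + j))" using large by blast
    show "i \<in> near_selected \<union> (\<Union>k<K. E2 k \<union> E3 k)"
    proof (rule ccontr)
      assume "\<not> ?thesis"
      then have 1: "i \<notin> near_selected" and 2: "\<not> \<alpha>\<^sup>2 < (fl k i)\<^sup>2" and 3: "\<not> \<alpha> < md k i"
        using k(1) i by (auto simp: E2_def E3_def)
      \<comment> \<open>A longer stopping interval met by the window would put i within its length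
        of a selected point.\<close>
      have "i + j \<notin> selected s" if "s > A (Suc k)" "j \<in> window k" for s j
      proof
        assume "i + j \<in> selected s"
        moreover have "\<bar>i - (i + j)\<bar> \<le> 2 ^ s"
        proof -
          have "\<bar>j\<bar> \<le> 2 ^ A (Suc k)" using that(2) by auto
          also have "\<dots> \<le> 2 ^ s" using that(1) by (intro power_increasing) auto
          finally show ?thesis by simp
        qed
        ultimately show False using 1 unfolding near_selected_def by blast
      qed
      then have "(\<Sum>j\<in>window k. w k j * F (i + j))
         \<le> (\<Sum>j\<in>window k. w k j * (2 * \<alpha> + fluctuation (A k) (i + j) + middle (A k) (A (Suc k)) (i + j)))"
        by (intro sum_mono mult_left_mono F_le_pieces w_nonneg) auto
      also have "\<dots> = 2 * \<alpha> * (\<Sum>j\<in>window k. w k j) + fl k i + md k i"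
        by (simp add: fl_def md_def algebra_simps sum.distrib sum_distrib_left)
      also have "\<dots> \<le> 2 * \<alpha> * 1 + \<alpha> + \<alpha>"
      proof (intro add_mono mult_left_mono w_sum_le)
        show "fl k i \<le> \<alpha>" using 2 \<alpha> by (meson abs_le_D1 abs_le_square_iff abs_of_pos not_less order_refl power2_le_imp_le less_imp_le)
      qed (use \<alpha> 3 in auto)
      finally show False using k(2) by simp
    qed
  qed
  have E2: "\<alpha> * real (card (E2 k)) \<le> 2 * (1/4) ^ k * total" for k
  proof -
    have "\<alpha>\<^sup>2 * real (card (E2 k)) \<le> (\<Sum>i\<in>I. (fl k i)\<^sup>2)"
      unfolding E2_def by (intro card_gt_le_sum I) auto
    also have "\<dots> = (\<Sum>i\<in>I. (\<Sum>j\<in>window k. w k j * (primitive (A k) (i + j + 1) - primitive (A k) (i + j)))\<^sup>2)"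
      by (simp only: fl_def fluctuation_eq_difference)
    also have "\<dots> \<le> (1 / (2 ^ k * 2 ^ A k))\<^sup>2 * (\<Sum>i\<in>(\<Union>s\<le>A k. selected s). (primitive (A k) i)\<^sup>2)"
    proof (rule l2_difference_bound[OF _ I])
      show "finite (\<Union>s\<le>A k. selected s)" by (simp add: finite_selected)
    qed (rule w_support primitive_outside w_hat; assumption)+
    also have "\<dots> \<le> (1 / (2 ^ k * 2 ^ A k))\<^sup>2 * (2 * \<alpha> * (2 ^ A k)\<^sup>2 * total)"
      by (intro mult_left_mono sum_primitive_squared_le) auto
    \<comment> \<open>The radius in the transform bound cancels the one from the primitives; what
      remains is 4^-k, summable in k.\<close>
    also have "\<dots> = \<alpha> * (2 * (1/4) ^ k * total)"
    proof -
      have "(1 / 2 ^ k)\<^sup>2 = (1/4::real) ^ k"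
        by (simp add: power_divide power2_eq_square flip: power_mult_distrib)
      moreover have "(1 / (2 ^ k * 2 ^ A k))\<^sup>2 * (2 ^ A k)\<^sup>2 = ((1 / 2 ^ k)\<^sup>2 :: real)"
        by (simp flip: power_mult_distrib)
      ultimately show ?thesis by (simp add: mult_ac)
    qed
    finally show ?thesis using \<alpha> by (simp add: power2_eq_square mult.assoc)
  qed
  have E3: "\<alpha> * real (card (E3 k)) \<le> (\<Sum>s\<in>{A k<..A (Suc k)}. \<Sum>i\<in>selected s. F i)" (is "_ \<le> ?m k") for k
  proof -
    have "\<alpha> * real (card (E3 k)) \<le> (\<Sum>i\<in>I. md k i)"
      unfolding E3_def by (intro card_gt_le_sum I md_nonneg)
    also have "\<dots> = (\<Sum>j\<in>window k. w k j * (\<Sum>i\<in>I. middle (A k) (A (Suc k)) (i + j)))"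
      unfolding md_def sum_distrib_left by (rule sum.swap)
    also have "\<dots> \<le> (\<Sum>j\<in>window k. w k j * ?m k)"
    proof (intro sum_mono mult_left_mono w_nonneg)
      fix j
      have "(\<Sum>i\<in>I. middle (A k) (A (Suc k)) (i + j)) = (\<Sum>i\<in>(\<lambda>i. i + j) ` I. middle (A k) (A (Suc k)) i)"
        by (simp add: sum.reindex)
      also have "\<dots> \<le> ?m k" using I by (intro sum_middle_le) auto
      finally show "(\<Sum>i\<in>I. middle (A k) (A (Suc k)) (i + j)) \<le> ?m k" .
    qed
    also have "\<dots> \<le> 1 * ?m k"
      unfolding sum_distrib_right[symmetric]
      by (intro mult_right_mono w_sum_le sum_nonneg F_nonneg)
    finally show ?thesis by simp
  qed
  \<comment> \<open>The ranges of scales for consecutive k abut without overlap, so the l1 bounds of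
    all k use the mass of \<open>F\<close> once.\<close>
  have "(\<Sum>k<K. ?m k) = (\<Sum>s\<in>{A 0<..A K}. \<Sum>i\<in>selected s. F i)"
  proof (induction K)
    case (Suc K)
    have "A 0 \<le> A K" "A K \<le> A (Suc K)"
      using strict_mono_A by (auto simp: strict_mono_less_eq)
    then have "{A 0<..A (Suc K)} = {A 0<..A K} \<union> {A K<..A (Suc K)}" by auto
    then show ?case using Suc by (simp add: sum.union_disjoint)
  qed simp
  then have m_total: "(\<Sum>k<K. ?m k) \<le> total" using sum_selected_le_total by simp
  have geo: "(\<Sum>k<K. (1/4::real) ^ k) \<le> 2"
  proof -
    have "(\<Sum>k<K. (1/4::real) ^ k) = ((1/4) ^ K - 1) / (1/4 - 1)" by (rule geometric_sum) simp
    moreover have "(q - 1) / (1/4 - 1) \<le> 2" if "q \<ge> 0" for q :: real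
      using that by (simp add: field_simps)
    ultimately show ?thesis by simp
  qed
  have "card I \<le> card (near_selected \<union> (\<Union>k<K. E2 k \<union> E3 k))"
    using near_selected_card(1) I by (intro card_mono cover) (auto simp: E2_def E3_def)
  also have "\<dots> \<le> card near_selected + card (\<Union>k<K. E2 k \<union> E3 k)" by (rule card_Un_le)
  also have "\<dots> \<le> card near_selected + (\<Sum>k<K. card (E2 k \<union> E3 k))"
    by (intro add_left_mono card_UN_le) simp
  also have "\<dots> \<le> card near_selected + (\<Sum>k<K. card (E2 k) + card (E3 k))"
    by (intro add_left_mono sum_mono card_Un_le)
  finally have "real (card I) \<le> real (card near_selected + (\<Sum>k<K. card (E2 k) + card (E3 k)))"
    by (simp only: of_nat_le_iff)
  then have "\<alpha> * real (card I) \<le> \<alpha> * real (card near_selected + (\<Sum>k<K. card (E2 k) + card (E3 k)))"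
    using \<alpha> by (intro mult_left_mono) auto
  also have "\<dots> = \<alpha> * real (card near_selected) + (\<Sum>k<K. \<alpha> * real (card (E2 k))) + (\<Sum>k<K. \<alpha> * real (card (E3 k)))"
    by (simp add: algebra_simps sum.distrib sum_distrib_left)
  \<comment> \<open>The final 8 is 3 + 4 + 1: enlargements, cancelling parts (twice a geometric
    series bounded by 2), intermediate lengths.\<close>
  also have "\<dots> \<le> 3 * total + (\<Sum>k<K. 2 * (1/4) ^ k * total) + (\<Sum>k<K. ?m k)"
    by (intro add_mono sum_mono near_selected_card E2 E3)
  also have "(\<Sum>k<K. 2 * (1/4) ^ k * total) = 2 * (\<Sum>k<K. (1/4) ^ k) * total"
    by (simp only: sum_distrib_left[symmetric] sum_distrib_right[symmetric])
  also have "\<dots> \<le> 2 * 2 * total"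
    using geo total_nonneg by (intro mult_right_mono mult_left_mono) auto
  finally show ?thesis using m_total by simp
qed

end

section \<open>Integer powers of the transformation and transference\<close>

context dynamical_system
begin

abbreviation T :: "int \<Rightarrow> 'a \<Rightarrow> 'a" where "T \<equiv> int_iterate M \<tau>"

lemma \<tau>_space: "x \<in> space M \<Longrightarrow> \<tau> x \<in> space M"
  using bij_\<tau> by (auto simp: bij_betw_def)

lemma inv_\<tau>: "x \<in> space M \<Longrightarrow> \<tau> (inv_into (space M) \<tau> x) = x"
  "x \<in> space M \<Longrightarrow> inv_into (space M) \<tau> (\<tau> x) = x"
  "x \<in> space M \<Longrightarrow> inv_into (space M) \<tau> x \<in> space M"
  using bij_\<tau> by (auto simp: bij_betw_def f_inv_into_f inv_into_f_f inv_into_into)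

lemma T_0 [simp]: "T 0 x = x" by (simp add: int_iterate_def)

lemma T_1 [simp]: "T 1 x = \<tau> x" by (simp add: int_iterate_def)

lemma T_space: "x \<in> space M \<Longrightarrow> T j x \<in> space M"
proof -
  assume x: "x \<in> space M"
  have "(\<tau> ^^ n) x \<in> space M" "(inv_into (space M) \<tau> ^^ n) x \<in> space M" for n
    by (induction n) (use x \<tau>_space inv_\<tau>(3) in auto)
  then show ?thesis by (simp add: int_iterate_def)
qed

lemma T_succ: "x \<in> space M \<Longrightarrow> T (j + 1) x = \<tau> (T j x)"
proof (cases "j \<ge> 0")
  case True
  then have "nat (j + 1) = Suc (nat j)" by simp
  then show ?thesis using True by (simp add: int_iterate_def)
next
  case False
  assume x: "x \<in> space M"
  define n where "n = nat (- (j + 1))"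
  have n: "nat (- j) = Suc n" "j + 1 \<le> 0" using False by (auto simp: n_def)
  have T': "T (j + 1) x = (inv_into (space M) \<tau> ^^ n) x"
    using n by (auto simp: int_iterate_def n_def)
  have "T j x = inv_into (space M) \<tau> ((inv_into (space M) \<tau> ^^ n) x)"
    using n False by (simp add: int_iterate_def)
  then show ?thesis using T_space[OF x, of "j + 1"] inv_\<tau>(1) unfolding T' by simp
qed

text \<open>In the downward step both sides are shown to have the same image under
  \<open>\<tau>\<close>, which is then cancelled on \<open>space M\<close>.\<close>

lemma T_add: "x \<in> space M \<Longrightarrow> T (i + j) x = T i (T j x)"
proof (induction i rule: int_induct[where k = 0])
  case (step1 i)
  have "T (i + 1 + j) x = T (i + j + 1) x" by (simp add: algebra_simps)
  then show ?case using step1 by (simp add: T_succ T_space)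
next
  case (step2 i)
  have "\<tau> (T (i - 1 + j) x) = T (i + j) x"
    using T_succ[of x "i - 1 + j"] step2 by (simp add: algebra_simps)
  moreover have "\<tau> (T (i - 1) (T j x)) = T i (T j x)"
    using T_succ[of "T j x" "i - 1"] step2 by (simp add: T_space)
  ultimately have "\<tau> (T (i - 1 + j) x) = \<tau> (T (i - 1) (T j x))" using step2 by simp
  then show ?case using inv_\<tau>(2) T_space step2 by metis
qed simp

lemma T_measurable [measurable]: "T j \<in> M \<rightarrow>\<^sub>M M"
proof -
  have "\<tau> ^^ n \<in> M \<rightarrow>\<^sub>M M" "inv_into (space M) \<tau> ^^ n \<in> M \<rightarrow>\<^sub>M M" for n
    by (induction n) (auto intro: measurable_comp measurable_\<tau> measurable_inv_\<tau>)
  then show ?thesis by (simp add: int_iterate_def)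
qed

lemma distr_T: "distr M M (T j) = M"
proof -
  note [measurable] = measurable_\<tau> measurable_inv_\<tau>
  have inv: "distr M M (inv_into (space M) \<tau>) = M"
  proof -
    \<comment> \<open>Rewriting \<open>M\<close> as its own image under \<open>\<tau>\<close> lets
      the inverse undo that image.\<close>
    have "distr M M (inv_into (space M) \<tau>) = distr (distr M M \<tau>) M (inv_into (space M) \<tau>)"
      by (simp add: preserving_\<tau>)
    also have "\<dots> = distr M M (inv_into (space M) \<tau> \<circ> \<tau>)" by (intro distr_distr) auto
    also have "\<dots> = distr M M (\<lambda>x. x)" by (intro distr_cong) (auto simp: inv_\<tau>)
    finally show ?thesis by simp
  qed
  have fp: "distr M M (g ^^ n) = M" if [measurable]: "g \<in> M \<rightarrow>\<^sub>M M" and g: "distr M M g = M" for g n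
  proof (induction n)
    case (Suc n)
    have [measurable]: "g ^^ n \<in> M \<rightarrow>\<^sub>M M"
      by (induction n) (auto intro: measurable_comp that)
    have "distr M M (g ^^ Suc n) = distr (distr M M (g ^^ n)) M g"
      by (subst distr_distr) auto
    then show ?case using Suc g by (simp add: comp_def)
  qed (simp add: id_def)
  show ?thesis by (auto simp: int_iterate_def inv preserving_\<tau> intro!: fp)
qed

lemma integrable_T:
  fixes f :: "'a \<Rightarrow> 'b :: {banach, second_countable_topology}"
  shows "integrable M f \<Longrightarrow> integrable M (\<lambda>x. f (T j x))"
  using integrable_distr[of "T j" M M f] distr_T by simp

lemma integral_T:
  fixes f :: "'a \<Rightarrow> 'b :: {banach, second_countable_topology}"
  assumes "f \<in> borel_measurable M"
  shows "(\<integral>x. f (T j x) \<partial>M) = (\<integral>x. f x \<partial>M)"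
  using integral_distr[of "T j" M M f] distr_T assms by simp

lemma nn_integral_T:
  assumes "f \<in> borel_measurable M"
  shows "(\<integral>\<^sup>+x. f (T j x) \<partial>M) = (\<integral>\<^sup>+x. f x \<partial>M)"
  using nn_integral_distr[of "T j" M M f] distr_T assms by simp

text \<open>Calderon's transference: an inequality along finite stretches of orbits, with a boundary
  error of fixed width, becomes an inequality of integrals.\<close>

lemma transference:
  fixes G H :: "'a \<Rightarrow> real"
  assumes G: "integrable M G" and H: "integrable M H" and R: "R \<ge> 0"
    and orbit: "\<And>x L. x \<in> space M \<Longrightarrow>
      (\<Sum>i\<in>{0..<int L}. G (T i x)) \<le> (\<Sum>i\<in>{-R..<int L + R}. H (T i x))"
  shows "(\<integral>x. G x \<partial>M) \<le> (\<integral>x. H x \<partial>M)"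
proof -
  define a b where "a = (\<integral>x. G x \<partial>M)" and "b = (\<integral>x. H x \<partial>M)"
  have ineq: "real L * a \<le> (real L + 2 * of_int R) * b" for L
  proof -
    have "real L * a = (\<integral>x. (\<Sum>i\<in>{0..<int L}. G (T i x)) \<partial>M)"
      using G by (simp add: integral_T integrable_T a_def)
    also have "\<dots> \<le> (\<integral>x. (\<Sum>i\<in>{-R..<int L + R}. H (T i x)) \<partial>M)"
      using G H orbit by (intro integral_mono) (auto intro!: integrable_T)
    also have "\<dots> = (real L + 2 * of_int R) * b"
      using H R by (simp add: integral_T integrable_T b_def)
    finally show ?thesis .
  qed
  \<comment> \<open>Dividing by the length of the stretch makes the boundary term vanish in the
    limit.\<close>
  have "a \<le> b + (2 * of_int R * b) / real (Suc L)" for L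
    using ineq[of "Suc L"] by (simp add: field_simps)
  moreover have "(\<lambda>L. b + (2 * of_int R * b) / real (Suc L)) \<longlonglongrightarrow> b + 0"
    by (intro tendsto_add tendsto_const LIMSEQ_Suc[OF lim_const_over_n])
  ultimately have "a \<le> b + 0"
    by (intro LIMSEQ_le_const[of "\<lambda>L. b + (2 * of_int R * b) / real (Suc L)"]) auto
  then show ?thesis by (simp add: a_def b_def)
qed

end

section \<open>The maximal inequality and the L2 bound for coboundaries on dynamical systems\<close>

locale weighted_system = dynamical_system M \<tau> + lacunary_weights w A
  for M :: "'a measure" and \<tau> w A
begin

definition V :: "nat \<Rightarrow> ('a \<Rightarrow> real) \<Rightarrow> 'a \<Rightarrow> real" where
  "V k f x = (\<Sum>j\<in>window k. w k j * f (T j x))"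

lemma V_measurable [measurable]:
  assumes [measurable]: "f \<in> borel_measurable M" shows "V k f \<in> borel_measurable M"
  unfolding V_def by measurable

lemma V_along_orbit: "x \<in> space M \<Longrightarrow> V k f (T i x) = (\<Sum>j\<in>window k. w k j * f (T (i + j) x))"
  unfolding V_def using T_add[of x _ i] by (simp add: add.commute)

lemma window_mono: "k \<le> K \<Longrightarrow> window k \<subseteq> window K"
proof -
  assume "k \<le> K"
  then have "A (Suc k) \<le> A (Suc K)" using strict_mono_A by (simp add: strict_mono_less_eq)
  then have "(2::int) ^ A (Suc k) \<le> 2 ^ A (Suc K)" by (intro power_increasing) auto
  then show ?thesis by auto
qed

text \<open>Finitely many weights fit into one window, whose radius is the fixed boundary width that
  transference asks for.\<close>

lemma maximal_inequality_finite:
  assumes f: "integrable M f" "\<And>x. f x \<ge> 0" and \<alpha>: "\<alpha> > 0"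
  shows "\<alpha> * measure M {x\<in>space M. \<exists>k<K. 4 * \<alpha> < V k f x} \<le> 8 * (\<integral>x. f x \<partial>M)"
proof -
  define E where "E = {x\<in>space M. \<exists>k<K. 4 * \<alpha> < V k f x}"
  have [measurable]: "f \<in> borel_measurable M" using f by auto
  have [measurable]: "E \<in> sets M" unfolding E_def by measurable
  define R :: int where "R = 2 ^ A (Suc K)"
  have "(\<integral>x. \<alpha> * indicator E x \<partial>M) \<le> (\<integral>x. 8 * f x \<partial>M)"
  proof (rule transference[where R = R])
    fix x L assume x: "x \<in> space M"
    define X where "X = {-R..<int L + R}"
    \<comment> \<open>The cut to finite support changes nothing that the windows around points of
      \<open>I\<close> can see.\<close>
    define F where "F i = (if i \<in> X then f (T i x) else 0)" for i
    define I where "I = {i\<in>{0..<int L}. T i x \<in> E}"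
    have "\<alpha> * real (card I) \<le> 8 * (\<Sum>i\<in>X. F i)"
    proof (rule discrete_maximal_inequality[where K = K])
      fix i assume i: "i \<in> I"
      then obtain k where k: "k < K" "4 * \<alpha> < V k f (T i x)" by (auto simp: I_def E_def)
      have "w k j * f (T (i + j) x) = w k j * F (i + j)" if "j \<in> window k" for j
      proof -
        have "j \<in> window K" using window_mono[of k K] k(1) that by (meson less_imp_le subsetD)
        then have "i + j \<in> X" using i by (auto simp: X_def R_def I_def)
        then show ?thesis by (simp add: F_def)
      qed
      then have "V k f (T i x) = (\<Sum>j\<in>window k. w k j * F (i + j))"
        unfolding V_along_orbit[OF x] by (intro sum.cong refl)
      then show "\<exists>k<K. 4 * \<alpha> < (\<Sum>j\<in>window k. w k j * F (i + j))" using k by auto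
    next
      show "finite I" unfolding I_def by (rule finite_subset[of _ "{0..<int L}"]) auto
    qed (use f \<alpha> in \<open>auto simp: X_def F_def\<close>)
    moreover have "(\<Sum>i\<in>{0..<int L}. \<alpha> * indicator E (T i x)) = \<alpha> * real (card I)"
    proof -
      have "I = {0..<int L} \<inter> {i. T i x \<in> E}" by (auto simp: I_def)
      then have "(\<Sum>i\<in>{0..<int L}. indicator E (T i x)) = real (card I)"
        by (simp add: indicator_def sum.If_cases)
      then show ?thesis by (simp flip: sum_distrib_left)
    qed
    moreover have "8 * (\<Sum>i\<in>X. F i) = (\<Sum>i\<in>{-R..<int L + R}. 8 * f (T i x))"
      by (simp add: X_def F_def sum_distrib_left)
    ultimately show "(\<Sum>i\<in>{0..<int L}. \<alpha> * indicator E (T i x)) \<le> (\<Sum>i\<in>{-R..<int L + R}. 8 * f (T i x))"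
      by (simp only:)
  qed (use f in \<open>auto simp: R_def emeasure_eq_measure\<close>)
  then show ?thesis by (simp add: E_def)
qed

lemma maximal_inequality:
  assumes f: "integrable M f" "\<And>x. f x \<ge> 0" and \<alpha>: "\<alpha> > 0"
  shows "\<alpha> * measure M {x\<in>space M. \<exists>k. 4 * \<alpha> < V k f x} \<le> 8 * (\<integral>x. f x \<partial>M)"
proof -
  define E where "E K = {x\<in>space M. \<exists>k<K. 4 * \<alpha> < V k f x}" for K
  have [measurable]: "f \<in> borel_measurable M" using f by auto
  have [measurable]: "E K \<in> sets M" for K unfolding E_def by measurable
  have "(\<lambda>K. measure M (E K)) \<longlonglongrightarrow> measure M (\<Union>K. E K)"
    by (intro finite_Lim_measure_incseq) (auto simp: incseq_def E_def intro: order.strict_trans2)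
  then have "(\<lambda>K. \<alpha> * measure M (E K)) \<longlonglongrightarrow> \<alpha> * measure M (\<Union>K. E K)"
    by (intro tendsto_mult tendsto_const)
  then have "\<alpha> * measure M (\<Union>K. E K) \<le> 8 * (\<integral>x. f x \<partial>M)"
    using maximal_inequality_finite[OF f \<alpha>] by (intro LIMSEQ_le_const2) (auto simp: E_def)
  moreover have "(\<Union>K. E K) = {x\<in>space M. \<exists>k. 4 * \<alpha> < V k f x}" by (auto simp: E_def)
  ultimately show ?thesis by simp
qed

text \<open>Along an orbit a coboundary is literally a difference of the sequence h(T^m x), so
  \<open>l2_difference_bound\<close> applies and transference turns it into an integral
  bound.\<close>

lemma integral_coboundary_squared_le:
  assumes [measurable]: "h \<in> borel_measurable M" and B: "\<And>x. \<bar>h x\<bar> \<le> B"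
  shows "(\<integral>x. (V k (\<lambda>x. h (\<tau> x) - h x) x)\<^sup>2 \<partial>M) \<le> (1/4) ^ k * B\<^sup>2"
    and "integrable M (\<lambda>x. (V k (\<lambda>x. h (\<tau> x) - h x) x)\<^sup>2)"
proof -
  note [measurable] = measurable_\<tau>
  define g where "g x = h (\<tau> x) - h x" for x
  have gm [measurable]: "g \<in> borel_measurable M" unfolding g_def by measurable
  have B0: "B \<ge> 0" using B[of undefined] by linarith
  have gB: "\<bar>g x\<bar> \<le> 2 * B" for x using B[of "\<tau> x"] B[of x] by (simp add: g_def)
  have VB: "\<bar>V k g x\<bar> \<le> 2 * B" for x
  proof -
    have "\<bar>V k g x\<bar> \<le> (\<Sum>j\<in>window k. w k j * (2 * B))"
      unfolding V_def by (rule order_trans[OF sum_abs]) (auto simp: abs_mult w_nonneg gB intro!: sum_mono mult_left_mono)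
    also have "\<dots> \<le> 1 * (2 * B)" unfolding sum_distrib_right[symmetric] using B0 by (intro mult_right_mono w_sum_le) auto
    finally show ?thesis by simp
  qed
  show int: "integrable M (\<lambda>x. (V k (\<lambda>x. h (\<tau> x) - h x) x)\<^sup>2)"
    unfolding g_def[symmetric]
  proof (rule integrable_const_bound[where B = "(2 * B)\<^sup>2"])
    show "AE x in M. norm ((V k g x)\<^sup>2) \<le> (2 * B)\<^sup>2"
    proof (intro AE_I2)
      fix x
      show "norm ((V k g x)\<^sup>2) \<le> (2 * B)\<^sup>2"
        using VB[of x] B0 abs_le_square_iff[of "V k g x" "2 * B"] by simp
    qed
  qed simp
  have hint: "integrable M (\<lambda>x. (h x)\<^sup>2)"
  proof (rule integrable_const_bound[where B = "B\<^sup>2"])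
    show "AE x in M. norm ((h x)\<^sup>2) \<le> B\<^sup>2"
      using B B0 by (intro AE_I2) (simp add: abs_le_square_iff[symmetric])
  qed simp
  define \<eta> :: real where "\<eta> = 1 / (2 ^ k * 2 ^ A k)"
  \<comment> \<open>The extra 1 makes room for \<open>c (i + j + 1)\<close>.\<close>
  define R :: int where "R = 2 ^ A (Suc k) + 1"
  have "(\<integral>x. (V k g x)\<^sup>2 \<partial>M) \<le> (\<integral>x. \<eta>\<^sup>2 * (h x)\<^sup>2 \<partial>M)"
  proof (rule transference[where R = R])
    fix x L assume x: "x \<in> space M"
    define C where "C = {-R..<int L + R}"
    define c where "c m = (if m \<in> C then h (T m x) else 0)" for m
    have "(\<Sum>i\<in>{0..<int L}. (V k g (T i x))\<^sup>2)
        = (\<Sum>i\<in>{0..<int L}. (\<Sum>j\<in>window k. w k j * (c (i + j + 1) - c (i + j)))\<^sup>2)"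
    proof (intro sum.cong refl arg_cong[where f = "\<lambda>x. x\<^sup>2"])
      fix i assume i: "i \<in> {0..<int L}"
      have "w k j * g (T (i + j) x) = w k j * (c (i + j + 1) - c (i + j))" if "j \<in> window k" for j
      proof -
        have "i + j + 1 \<in> C" "i + j \<in> C" using i that by (auto simp: C_def R_def)
        then show ?thesis using T_succ[OF x, of "i + j"] by (simp add: c_def g_def)
      qed
      then show "V k g (T i x) = (\<Sum>j\<in>window k. w k j * (c (i + j + 1) - c (i + j)))"
        unfolding V_along_orbit[OF x] by (intro sum.cong refl)
    qed
    also have "\<dots> \<le> \<eta>\<^sup>2 * (\<Sum>m\<in>C. (c m)\<^sup>2)"
    proof (rule l2_difference_bound)
      show "finite C" by (simp add: C_def)
      show "c m = 0" if "m \<notin> C" for m using that by (simp add: c_def)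
    qed (auto simp: \<eta>_def intro: w_hat w_support)
    finally show "(\<Sum>i\<in>{0..<int L}. (V k g (T i x))\<^sup>2) \<le> (\<Sum>i\<in>{-R..<int L + R}. \<eta>\<^sup>2 * (h (T i x))\<^sup>2)"
      by (simp add: C_def c_def sum_distrib_left)
  qed (use int[folded g_def] hint in \<open>auto simp: R_def\<close>)
  also have "\<dots> \<le> (\<integral>x. (1/4) ^ k * B\<^sup>2 \<partial>M)"
  proof (rule integral_mono)
    fix x
    \<comment> \<open>For bounded coboundaries the factor 2^-k alone is enough.\<close>
    have "\<eta> \<le> 1 / 2 ^ k" by (simp add: \<eta>_def field_simps)
    then have "\<eta>\<^sup>2 \<le> (1 / 2 ^ k)\<^sup>2" by (intro power_mono) (auto simp: \<eta>_def)
    also have "\<dots> = (1/4) ^ k" by (simp add: power_divide power2_eq_square flip: power_mult_distrib)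
    finally have "\<eta>\<^sup>2 \<le> (1/4) ^ k" .
    moreover have "(h x)\<^sup>2 \<le> B\<^sup>2" using B B0 by (simp add: abs_le_square_iff[symmetric])
    ultimately show "\<eta>\<^sup>2 * (h x)\<^sup>2 \<le> (1/4) ^ k * B\<^sup>2" by (intro mult_mono) auto
  qed (use hint in auto)
  finally show "(\<integral>x. (V k (\<lambda>x. h (\<tau> x) - h x) x)\<^sup>2 \<partial>M) \<le> (1/4) ^ k * B\<^sup>2"
    unfolding g_def[symmetric] by (simp add: prob_space)
qed

end

section \<open>The mean ergodic theorem and coboundaries\<close>

lemma AE_summable_of_summable_integrals:
  fixes g :: "nat \<Rightarrow> 'b \<Rightarrow> real"
  assumes int: "\<And>n. integrable M (g n)" and nn: "\<And>n x. g n x \<ge> 0"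
    and s: "summable (\<lambda>n. \<integral>x. g n x \<partial>M)"
  shows "AE x in M. summable (\<lambda>n. g n x)"
proof -
  have [measurable]: "g n \<in> borel_measurable M" for n using int by auto
  have "(\<integral>\<^sup>+x. (\<Sum>n. ennreal (g n x)) \<partial>M) = (\<Sum>n. \<integral>\<^sup>+x. ennreal (g n x) \<partial>M)"
    by (intro nn_integral_suminf) auto
  also have "\<dots> = (\<Sum>n. ennreal (\<integral>x. g n x \<partial>M))"
    using int nn by (simp add: nn_integral_eq_integral)
  also have "\<dots> < \<infinity>"
    using s nn by (simp add: suminf_ennreal2 less_top[symmetric] integral_nonneg_AE)
  finally have "AE x in M. (\<Sum>n. ennreal (g n x)) \<noteq> \<infinity>"
    by (intro nn_integral_PInf_AE) auto
  then show ?thesis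
    by eventually_elim (use nn in \<open>auto intro: summable_suminf_not_top\<close>)
qed

text \<open>Exceptional sets of measure at most 1/(n + 1) intersect in a null set. This is how a
  weak type estimate, which yields sets of small measure, leads to an almost everywhere
  statement.\<close>

lemma (in finite_measure) AE_if_exceptional_sets_small:
  assumes "\<And>\<epsilon>::real. \<epsilon> > 0 \<Longrightarrow> \<exists>E\<in>sets M. measure M E \<le> \<epsilon> \<and> (AE x in M. x \<notin> E \<longrightarrow> P x)"
  shows "AE x in M. P x"
proof -
  have "\<exists>E. \<forall>n::nat. E n \<in> sets M \<and> measure M (E n) \<le> 1 / real (Suc n) \<and> (AE x in M. x \<notin> E n \<longrightarrow> P x)"
    by (rule choice) (use assms in \<open>auto simp: Bex_def\<close>)
  then obtain E where E: "\<And>n. E n \<in> sets M" "\<And>n. measure M (E n) \<le> 1 / real (Suc n)"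
      "\<And>n. AE x in M. x \<notin> E n \<longrightarrow> P x" by blast
  define N where "N = (\<Inter>n. E n)"
  have N: "N \<in> sets M" using E(1) by (auto simp: N_def)
  have "measure M N \<le> 1 / real (Suc n)" for n
  proof -
    have "measure M N \<le> measure M (E n)" using E(1) by (intro finite_measure_mono) (auto simp: N_def)
    then show ?thesis using E(2)[of n] by simp
  qed
  then have "measure M N \<le> 0"
    using LIMSEQ_inverse_real_of_nat by (intro LIMSEQ_le_const[of "\<lambda>n. inverse (real (Suc n))"]) (auto simp: inverse_eq_divide)
  then have "emeasure M N = 0" by (simp add: emeasure_eq_measure measure_le_0_iff)
  then have "AE x in M. x \<notin> N" using N by (intro AE_not_in) auto
  moreover have "AE x in M. \<forall>n. x \<notin> E n \<longrightarrow> P x" using E(3) unfolding AE_all_countable by blast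
  ultimately show ?thesis by eventually_elim (auto simp: N_def)
qed

section \<open>Orbit averages, their invariant limits, and the dense class\<close>

context dynamical_system
begin

definition orbit_average :: "nat \<Rightarrow> ('a \<Rightarrow> real) \<Rightarrow> 'a \<Rightarrow> real" where
  "orbit_average n f x = (\<Sum>i<n. f (T (int i) x)) / real n"

lemma orbit_average_measurable [measurable]:
  assumes [measurable]: "f \<in> borel_measurable M" shows "orbit_average n f \<in> borel_measurable M"
  unfolding orbit_average_def by measurable

lemma orbit_average_bounded:
  assumes "\<And>x. \<bar>f x\<bar> \<le> B" shows "\<bar>orbit_average n f x\<bar> \<le> B"
proof (cases "n = 0")
  case True
  then show ?thesis using assms[of x] by (simp add: orbit_average_def)
next
  case False
  have "\<bar>\<Sum>i<n. f (T (int i) x)\<bar> \<le> (\<Sum>i<n. B)"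
    by (rule order_trans[OF sum_abs]) (intro sum_mono assms)
  then show ?thesis using False by (simp add: orbit_average_def abs_divide field_simps)
qed

text \<open>One application of \<open>\<tau>\<close> changes the sum by its two end terms only; m
  applications add up.\<close>

lemma orbit_average_shift:
  assumes B: "\<And>x. \<bar>f x\<bar> \<le> B" and x: "x \<in> space M"
  shows "\<bar>orbit_average n f (T (int m) x) - orbit_average n f x\<bar> \<le> 2 * real m * B / real n"
proof (induction m)
  case (Suc m)
  define y where "y = T (int m) x"
  have y: "y \<in> space M" using x by (simp add: y_def T_space)
  have Ty: "T (int (Suc m)) x = T 1 y"
    using T_add[OF x, of 1 "int m"] by (simp add: y_def)
  have "orbit_average n f (T 1 y) - orbit_average n f y
      = (\<Sum>i<n. f (T (int (Suc i)) y) - f (T (int i) y)) / real n"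
  proof -
    have "T (int i) (T 1 y) = T (int (Suc i)) y" for i
      using T_add[OF y, of "int i" 1] by (simp add: add.commute)
    then show ?thesis by (simp only: orbit_average_def sum_subtractf diff_divide_distrib)
  qed
  also have "\<dots> = (f (T (int n) y) - f (T (int 0) y)) / real n"
    by (subst sum_lessThan_telescope) (rule refl)
  finally have "\<bar>orbit_average n f (T 1 y) - orbit_average n f y\<bar> \<le> 2 * B / real n"
    using B[of "T (int n) y"] B[of y] by (auto simp: abs_divide intro!: divide_right_mono)
  then show ?case using Suc unfolding Ty y_def[symmetric]
    by (simp add: algebra_simps add_divide_distrib)
qed simp

lemma integrable_bounded:
  fixes f :: "'a \<Rightarrow> real"
  assumes "f \<in> borel_measurable M" "\<And>x. \<bar>f x\<bar> \<le> B" shows "integrable M f"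
  using assms by (intro integrable_const_bound[where B = B]) auto

lemma integrable_square_bounded:
  fixes f :: "'a \<Rightarrow> real"
  assumes [measurable]: "f \<in> borel_measurable M" and B: "\<And>x. \<bar>f x\<bar> \<le> B"
  shows "integrable M (\<lambda>x. (f x)\<^sup>2)"
proof (rule integrable_bounded[where B = "B\<^sup>2"])
  fix x
  show "\<bar>(f x)\<^sup>2\<bar> \<le> B\<^sup>2" using power_mono[OF B abs_ge_zero, of x 2] by simp
qed measurable

text \<open>Cauchy-Schwarz inside the average, then invariance of the measure.\<close>

lemma integral_orbit_average_squared_le:
  assumes [measurable]: "f \<in> borel_measurable M" and B: "\<And>x. \<bar>f x\<bar> \<le> B"
  shows "(\<integral>x. (orbit_average n f x)\<^sup>2 \<partial>M) \<le> (\<integral>x. (f x)\<^sup>2 \<partial>M)"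
proof (cases "n = 0")
  case False
  have int: "integrable M (\<lambda>x. (f x)\<^sup>2)" by (rule integrable_square_bounded[OF _ B]) measurable
  have "(\<integral>x. (orbit_average n f x)\<^sup>2 \<partial>M) \<le> (\<integral>x. (\<Sum>i<n. (f (T (int i) x))\<^sup>2) / real n \<partial>M)"
  proof (rule integral_mono)
    show "integrable M (\<lambda>x. (orbit_average n f x)\<^sup>2)"
      by (rule integrable_square_bounded[OF _ orbit_average_bounded[OF B]]) measurable
    fix x
    have "(\<Sum>i<n. f (T (int i) x))\<^sup>2 \<le> (\<Sum>i<n. (f (T (int i) x))\<^sup>2) * real n"
      using sum_squared_le_sum_of_squares[of "\<lambda>i. f (T (int i) x)" "{..<n}"] by simp
    then show "(orbit_average n f x)\<^sup>2 \<le> (\<Sum>i<n. (f (T (int i) x))\<^sup>2) / real n"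
      using False by (simp add: orbit_average_def power_divide field_simps power2_eq_square)
  qed (use int integrable_T[OF int] in auto)
  also have "\<dots> = (\<integral>x. (f x)\<^sup>2 \<partial>M)"
    using False int integral_T[of "\<lambda>x. (f x)\<^sup>2"] integrable_T[OF int] by simp
  finally show ?thesis .
qed (simp add: orbit_average_def)

text \<open>After exchanging the sums, the iterated average is a mean over q < m of shifted
  averages, each controlled by \<open>orbit_average_shift\<close>.\<close>

lemma orbit_average_orbit_average:
  assumes B: "\<And>x. \<bar>f x\<bar> \<le> B" and x: "x \<in> space M" and m: "m > 0"
  shows "\<bar>orbit_average n (orbit_average m f) x - orbit_average n f x\<bar> \<le> 2 * real m * B / real n"
proof -
  have B0: "B \<ge> 0" using B[of x] by linarith
  have swap: "f (T (int q) (T (int i) x)) = f (T (int i) (T (int q) x))" for q i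
    using T_add[OF x, of "int i" "int q"] T_add[OF x, of "int q" "int i"] by (simp add: add.commute)
  have "orbit_average n (orbit_average m f) x
      = (\<Sum>q<m. orbit_average n f (T (int q) x)) / real m"
  proof -
    have "(\<Sum>i<n. \<Sum>q<m. f (T (int q) (T (int i) x))) = (\<Sum>q<m. \<Sum>i<n. f (T (int i) (T (int q) x)))"
      by (subst sum.swap) (intro sum.cong refl swap)
    then show ?thesis by (simp add: orbit_average_def mult.commute flip: sum_divide_distrib)
  qed
  then have "orbit_average n (orbit_average m f) x - orbit_average n f x
      = (\<Sum>q<m. orbit_average n f (T (int q) x) - orbit_average n f x) / real m"
    using m by (simp add: sum_subtractf field_simps)
  also have "\<bar>\<dots>\<bar> \<le> (\<Sum>q<m. 2 * real m * B / real n) / real m"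
    unfolding abs_divide abs_of_nat
  proof (intro divide_right_mono order_trans[OF sum_abs] sum_mono)
    fix q assume "q \<in> {..<m}"
    have "\<bar>orbit_average n f (T (int q) x) - orbit_average n f x\<bar> \<le> 2 * real q * B / real n"
      by (rule orbit_average_shift[OF B x])
    also have "\<dots> \<le> 2 * real m * B / real n"
      using \<open>q \<in> {..<m}\<close> B0 by (intro divide_right_mono mult_right_mono mult_left_mono) auto
    finally show "\<bar>orbit_average n f (T (int q) x) - orbit_average n f x\<bar> \<le> 2 * real m * B / real n" .
  qed simp
  also have "\<dots> = 2 * real m * B / real n" using m by simp
  finally show ?thesis .
qed

text \<open>Averaging a midpoint of two averages of \<open>f\<close> over a long stretch gives nearly the long average
  of \<open>f\<close>, so midpoints have almost minimal norm and the parallelogram law applies.\<close>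

lemma integral_midpoint_squared_ge:
  assumes [measurable]: "f \<in> borel_measurable M" and B: "\<And>x. \<bar>f x\<bar> \<le> B"
    and ij: "0 < i" "0 < j" "i \<le> m" "j \<le> m" and n: "n > 0"
  shows "(\<integral>x. (orbit_average n f x)\<^sup>2 \<partial>M)
     \<le> (\<integral>x. ((orbit_average i f x + orbit_average j f x) / 2)\<^sup>2 \<partial>M) + 4 * real m * B\<^sup>2 / real n"
proof -
  have B0: "B \<ge> 0" using B[of undefined] by linarith
  define P where "P x = (orbit_average i f x + orbit_average j f x) / 2" for x
  have [measurable]: "P \<in> borel_measurable M" unfolding P_def by measurable
  have PB: "\<bar>P x\<bar> \<le> B" for x
    using orbit_average_bounded[where f = f and n = i and x = x, OF B] orbit_average_bounded[where f = f and n = j and x = x, OF B] by (auto simp: P_def)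
  have aP: "orbit_average n P x
      = (orbit_average n (orbit_average i f) x + orbit_average n (orbit_average j f) x) / 2" for x
    unfolding orbit_average_def[of n] P_def
    by (simp add: sum.distrib add_divide_distrib flip: sum_divide_distrib)
  \<comment> \<open>The error 2 m B / n between the two averages times the bound 2 B on the modulus
    of their sum.\<close>
  define c where "c = 4 * real m * B\<^sup>2 / real n"
  have "(\<integral>x. (orbit_average n f x)\<^sup>2 \<partial>M) \<le> (\<integral>x. (orbit_average n P x)\<^sup>2 + c \<partial>M)"
  proof (rule integral_mono)
    show "integrable M (\<lambda>x. (orbit_average n f x)\<^sup>2)"
      by (rule integrable_square_bounded[OF _ orbit_average_bounded[OF B]]) measurable
    have "integrable M (\<lambda>x. (orbit_average n P x)\<^sup>2)"
      by (rule integrable_square_bounded[OF _ orbit_average_bounded[OF PB]]) measurable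
    then show "integrable M (\<lambda>x. (orbit_average n P x)\<^sup>2 + c)" by simp
    fix x assume x: "x \<in> space M"
    define a b where "a = orbit_average n f x" and "b = orbit_average n P x"
    define t where "t = 2 * real m * B / real n"
    have "\<bar>orbit_average n (orbit_average p f) x - a\<bar> \<le> t" if "0 < p" "p \<le> m" for p
    proof -
      have "\<bar>orbit_average n (orbit_average p f) x - a\<bar> \<le> 2 * real p * B / real n"
        unfolding a_def by (rule orbit_average_orbit_average[OF B x that(1)])
      also have "\<dots> \<le> t"
        unfolding t_def using that B0 by (intro divide_right_mono mult_right_mono mult_left_mono) auto
      finally show ?thesis .
    qed
    from this[OF ij(1,3)] this[OF ij(2,4)] have d: "\<bar>a - b\<bar> \<le> t"
      unfolding b_def aP by (auto simp: abs_le_iff field_simps)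
    have s: "\<bar>a + b\<bar> \<le> 2 * B"
      using orbit_average_bounded[where f = f and n = n and x = x, OF B] orbit_average_bounded[where f = P and n = n and x = x, OF PB]
      by (auto simp: a_def b_def)
    have "a\<^sup>2 - b\<^sup>2 = (a - b) * (a + b)" by (simp add: power2_eq_square algebra_simps)
    also have "\<dots> \<le> \<bar>a - b\<bar> * \<bar>a + b\<bar>" by (metis abs_ge_self abs_mult)
    also have "\<dots> \<le> t * (2 * B)" using d s by (intro mult_mono) auto
    also have "\<dots> = c" by (simp add: t_def c_def power2_eq_square)
    finally show "(orbit_average n f x)\<^sup>2 \<le> (orbit_average n P x)\<^sup>2 + c" by (simp add: a_def b_def)
  qed
  also have "\<dots> = (\<integral>x. (orbit_average n P x)\<^sup>2 \<partial>M) + c"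
    by (subst Bochner_Integration.integral_add)
       (auto simp: prob_space intro!: integrable_square_bounded[OF _ orbit_average_bounded[OF PB]])
  also have "(\<integral>x. (orbit_average n P x)\<^sup>2 \<partial>M) \<le> (\<integral>x. (P x)\<^sup>2 \<partial>M)"
    by (rule integral_orbit_average_squared_le[OF _ PB]) measurable
  finally show ?thesis by (simp add: P_def c_def)
qed

text \<open>The squared norms \<open>d n\<close> approach their infimum, and midpoints cannot fall
  below it; the parallelogram law then makes the averages Cauchy.\<close>

lemma mean_ergodic_L2:
  assumes [measurable]: "f \<in> borel_measurable M" and B: "\<And>x. \<bar>f x\<bar> \<le> B" and \<epsilon>: "\<epsilon> > 0"
  shows "\<exists>N. \<forall>i\<ge>N. \<forall>j\<ge>N. (\<integral>x. (orbit_average i f x - orbit_average j f x)\<^sup>2 \<partial>M) \<le> \<epsilon>"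
proof -
  define d where "d n = (\<integral>x. (orbit_average n f x)\<^sup>2 \<partial>M)" for n
  define \<delta> where "\<delta> = Inf (d ` {0<..})"
  have d0: "d n \<ge> 0" for n by (simp add: d_def)
  have \<delta>le: "\<delta> \<le> d n" if "n > 0" for n
    unfolding \<delta>_def using that d0 by (intro cInf_lower bdd_belowI[of _ 0]) auto
  have ints: "integrable M (\<lambda>x. (orbit_average n f x)\<^sup>2)" for n
    by (rule integrable_square_bounded[OF _ orbit_average_bounded[OF B]]) measurable
  have lim0: "(\<lambda>n. c + 4 * real m * B\<^sup>2 / real n) \<longlonglongrightarrow> c" for c m
    using tendsto_add[OF tendsto_const lim_const_over_n[of "4 * real m * B\<^sup>2"]] by simp
  obtain m where m: "m > 0" "d m < \<delta> + \<epsilon> / 8"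
    using cInf_lessD[of "d ` {0<..}" "\<delta> + \<epsilon> / 8"] \<epsilon> by (auto simp: \<delta>_def)
  have "\<forall>\<^sub>F n in sequentially. d m + 4 * real m * B\<^sup>2 / real n < \<delta> + \<epsilon> / 4"
    using m(2) \<epsilon> by (intro order_tendstoD(2)[OF lim0]) simp
  then have "\<forall>\<^sub>F n in sequentially. d n < \<delta> + \<epsilon> / 4 \<and> n > 0"
    using eventually_gt_at_top[of 0]
  proof eventually_elim
    case (elim n)
    \<comment> \<open>The midpoint of an average with itself: both indices are taken to be
      m.\<close>
    have "d n \<le> d m + 4 * real m * B\<^sup>2 / real n"
      using integral_midpoint_squared_ge[OF _ B m(1) m(1) order_refl order_refl elim(2)]
      by (simp add: d_def)
    then show ?case using elim by simp
  qed
  then obtain N where N: "\<And>n. n \<ge> N \<Longrightarrow> d n < \<delta> + \<epsilon> / 4 \<and> n > 0"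
    by (auto simp: eventually_sequentially)
  show ?thesis
  proof (intro exI[of _ N] allI impI)
    fix i j assume "i \<ge> N" "j \<ge> N"
    then have i: "i > 0" "d i < \<delta> + \<epsilon> / 4" and j: "j > 0" "d j < \<delta> + \<epsilon> / 4" using N by auto
    define p where "p = (\<integral>x. ((orbit_average i f x + orbit_average j f x) / 2)\<^sup>2 \<partial>M)"
    have intp: "integrable M (\<lambda>x. ((orbit_average i f x + orbit_average j f x) / 2)\<^sup>2)"
    proof (rule integrable_square_bounded[where B = B])
      fix x show "\<bar>(orbit_average i f x + orbit_average j f x) / 2\<bar> \<le> B"
        using orbit_average_bounded[where f = f and n = i and x = x, OF B] orbit_average_bounded[where f = f and n = j and x = x, OF B] by auto
    qed measurable
    \<comment> \<open>A midpoint need not be an orbit average, so it is compared with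
      \<open>d n\<close> up to an error that vanishes as n grows.\<close>
    have "\<delta> \<le> p"
    proof (rule LIMSEQ_le_const[OF lim0[of p "max i j"]], intro exI[of _ 1] allI impI)
      fix n :: nat assume "n \<ge> 1"
      then have "d n \<le> p + 4 * real (max i j) * B\<^sup>2 / real n"
        unfolding d_def p_def by (intro integral_midpoint_squared_ge B i j) auto
      then show "\<delta> \<le> p + 4 * real (max i j) * B\<^sup>2 / real n" using \<delta>le[of n] \<open>n \<ge> 1\<close> by simp
    qed
    have "(\<integral>x. (orbit_average i f x - orbit_average j f x)\<^sup>2 \<partial>M)
        = (\<integral>x. 2 * (orbit_average i f x)\<^sup>2 + 2 * (orbit_average j f x)\<^sup>2
            - 4 * ((orbit_average i f x + orbit_average j f x) / 2)\<^sup>2 \<partial>M)"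
      by (intro Bochner_Integration.integral_cong refl) (simp add: power2_eq_square field_simps)
    \<comment> \<open>As \<open>d i\<close> and \<open>d j\<close> are below \<delta> + \<epsilon>/4
      and p is at least \<delta>, this is at most \<epsilon>.\<close>
    also have "\<dots> = 2 * d i + 2 * d j - 4 * p"
      using ints intp by (simp add: d_def p_def del: power_divide)
    finally show "(\<integral>x. (orbit_average i f x - orbit_average j f x)\<^sup>2 \<partial>M) \<le> \<epsilon>"
      using i j \<open>\<delta> \<le> p\<close> by simp
  qed
qed

text \<open>Along a fast subsequence the L2 Cauchy property becomes almost everywhere convergence,
  and dominated convergence returns to L1.\<close>

lemma invariant_limit:
  assumes [measurable]: "f \<in> borel_measurable M" and B: "\<And>x. \<bar>f x\<bar> \<le> B" and \<epsilon>: "\<epsilon> > 0"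
  shows "\<exists>g n. g \<in> borel_measurable M \<and> (\<forall>x. \<bar>g x\<bar> \<le> B) \<and> (\<forall>x\<in>space M. g (\<tau> x) = g x) \<and>
    n > 0 \<and> (\<integral>x. \<bar>orbit_average n f x - g x\<bar> \<partial>M) \<le> \<epsilon>"
proof -
  have B0: "B \<ge> 0" using B[of undefined] by linarith
  have "\<forall>m. \<exists>N. \<forall>i\<ge>N. \<forall>j\<ge>N. (\<integral>x. (orbit_average i f x - orbit_average j f x)\<^sup>2 \<partial>M) \<le> (1/16) ^ m"
    by (intro allI mean_ergodic_L2[OF assms(1) B]) auto
  then obtain N where N: "\<And>m i j. i \<ge> N m \<Longrightarrow> j \<ge> N m \<Longrightarrow>
      (\<integral>x. (orbit_average i f x - orbit_average j f x)\<^sup>2 \<partial>M) \<le> (1/16) ^ m"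
    by metis
  \<comment> \<open>Passes the threshold \<open>N m\<close>, increases, and tends to infinity by the
    summand m + 1; the last point gives invariance of the limit.\<close>
  define s where "s m = (\<Sum>q\<le>m. N q) + Suc m" for m
  have s: "s m \<ge> N m" "s m \<ge> Suc m" "s (Suc m) \<ge> s m" for m
  proof -
    have "N m \<le> (\<Sum>q\<le>m. N q)" by (rule member_le_sum) auto
    then show "s m \<ge> N m" "s m \<ge> Suc m" "s (Suc m) \<ge> s m" by (simp_all add: s_def)
  qed
  define \<Delta> where "\<Delta> m x = orbit_average (s (Suc m)) f x - orbit_average (s m) f x" for m x
  have [measurable]: "\<Delta> m \<in> borel_measurable M" for m unfolding \<Delta>_def by measurable
  have \<Delta>B: "\<bar>\<Delta> m x\<bar> \<le> 2 * B" for m x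
    using orbit_average_bounded[where f = f and n = "s m" and x = x, OF B]
      orbit_average_bounded[where f = f and n = "s (Suc m)" and x = x, OF B] by (auto simp: \<Delta>_def)
  have int\<Delta>: "integrable M (\<lambda>x. (\<Delta> m x)\<^sup>2)" for m
    by (rule integrable_square_bounded[OF _ \<Delta>B]) measurable
  \<comment> \<open>The weight 4^m still leaves integrals of at most 4^-m, while terms tending to 0
    force |\<Delta> m x| \<le> 2^-m eventually.\<close>
  have "AE x in M. summable (\<lambda>m. 4 ^ m * (\<Delta> m x)\<^sup>2)"
  proof (rule AE_summable_of_summable_integrals)
    show "summable (\<lambda>m. \<integral>x. 4 ^ m * (\<Delta> m x)\<^sup>2 \<partial>M)"
    proof (rule summable_comparison_test')
      show "summable (\<lambda>m. (1/4::real) ^ m)" by (rule summable_geometric) simp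
      fix m :: nat
      have "(\<integral>x. (\<Delta> m x)\<^sup>2 \<partial>M) \<le> (1/16) ^ m"
        unfolding \<Delta>_def using s(1)[of m] s(3)[of m] by (intro N) auto
      then have "4 ^ m * (\<integral>x. (\<Delta> m x)\<^sup>2 \<partial>M) \<le> 4 ^ m * (1/16) ^ m" by simp
      also have "\<dots> = (1/4) ^ m" by (simp flip: power_mult_distrib)
      finally show "norm (\<integral>x. 4 ^ m * (\<Delta> m x)\<^sup>2 \<partial>M) \<le> (1/4) ^ m" by simp
    qed
  qed (use int\<Delta> in auto)
  then have conv: "AE x in M. convergent (\<lambda>m. orbit_average (s m) f x)"
  proof eventually_elim
    case (elim x)
    have "(\<lambda>m. 4 ^ m * (\<Delta> m x)\<^sup>2) \<longlonglongrightarrow> 0" by (rule summable_LIMSEQ_zero[OF elim])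
    then have "\<forall>\<^sub>F m in sequentially. 4 ^ m * (\<Delta> m x)\<^sup>2 < 1" by (rule order_tendstoD) simp
    then have "\<forall>\<^sub>F m in sequentially. norm (\<Delta> m x) \<le> (1/2) ^ m"
    proof eventually_elim
      case (elim m)
      have "(2 ^ m * \<bar>\<Delta> m x\<bar>)\<^sup>2 = 4 ^ m * (\<Delta> m x)\<^sup>2"
      proof -
        have "(2 ^ m)\<^sup>2 = (4::real) ^ m" by (simp add: power2_eq_square flip: power_mult_distrib)
        then show ?thesis unfolding power_mult_distrib by simp
      qed
      then have "(2 ^ m * \<bar>\<Delta> m x\<bar>)\<^sup>2 \<le> 1\<^sup>2" using elim by simp
      then have "2 ^ m * \<bar>\<Delta> m x\<bar> \<le> 1" by (rule power2_le_imp_le) simp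
      then show ?case by (simp add: power_one_over field_simps)
    qed
    then have "summable (\<lambda>m. \<Delta> m x)"
      by (rule summable_comparison_test_ev) (rule summable_geometric, simp)
    then have "convergent (\<lambda>m. \<Sum>q<m. \<Delta> q x)" by (simp add: summable_iff_convergent)
    moreover have "(\<Sum>q<m. \<Delta> q x) = orbit_average (s m) f x - orbit_average (s 0) f x" for m
      unfolding \<Delta>_def by (rule sum_lessThan_telescope)
    ultimately have "convergent (\<lambda>m. orbit_average (s m) f x - orbit_average (s 0) f x)" by simp
    from convergent_add[OF this convergent_const[of "orbit_average (s 0) f x"]] show ?case by simp
  qed
  \<comment> \<open>The convergence set is invariant within \<open>space M\<close>, so the value 0
    off it keeps g invariant at every point of the space, not just almost everywhere.\<close>
  define g where "g x = (if convergent (\<lambda>m. orbit_average (s m) f x)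
    then lim (\<lambda>m. orbit_average (s m) f x) else 0)" for x
  have g [measurable]: "g \<in> borel_measurable M"
    unfolding g_def Cauchy_convergent_iff[symmetric] by measurable
  have lim_g: "(\<lambda>m. orbit_average (s m) f x) \<longlonglongrightarrow> g x" if "convergent (\<lambda>m. orbit_average (s m) f x)" for x
    using that by (simp add: g_def convergent_LIMSEQ_iff)
  have gB: "\<bar>g x\<bar> \<le> B" for x
  proof (cases "convergent (\<lambda>m. orbit_average (s m) f x)")
    case True
    show ?thesis
      by (rule LIMSEQ_le_const2[OF tendsto_rabs[OF lim_g[OF True]]])
         (use orbit_average_bounded[OF B] in auto)
  qed (use B0 in \<open>simp add: g_def\<close>)
  have inv: "g (\<tau> x) = g x" if x: "x \<in> space M" for x
  proof -
    define r where "r m = orbit_average (s m) f (\<tau> x) - orbit_average (s m) f x" for m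
    have "norm (r m) \<le> 2 * B / real (Suc m)" for m
    proof -
      have "\<bar>r m\<bar> \<le> 2 * B / real (s m)"
        using orbit_average_shift[OF B x, where n = "s m" and m = 1] by (simp add: r_def)
      also have "\<dots> \<le> 2 * B / real (Suc m)" using s(2)[of m] B0 by (intro divide_left_mono) auto
      finally show ?thesis by simp
    qed
    then have r0: "r \<longlonglongrightarrow> 0"
      by (intro Lim_null_comparison[OF _ LIMSEQ_Suc[OF lim_const_over_n[of "2 * B"]]]) auto
    have eq: "(\<lambda>m. orbit_average (s m) f (\<tau> x)) = (\<lambda>m. orbit_average (s m) f x + r m)"
      by (simp add: r_def)
    show ?thesis
    proof (cases "convergent (\<lambda>m. orbit_average (s m) f x)")
      case True
      have "(\<lambda>m. orbit_average (s m) f (\<tau> x)) \<longlonglongrightarrow> g x"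
        using tendsto_add[OF lim_g[OF True] r0] by (simp add: eq)
      then show ?thesis using lim_g LIMSEQ_unique convergentI by metis
    next
      case False
      have "\<not> convergent (\<lambda>m. orbit_average (s m) f (\<tau> x))"
      proof
        assume "convergent (\<lambda>m. orbit_average (s m) f (\<tau> x))"
        from convergent_diff[OF this convergentI[OF r0]] show False using False by (simp add: r_def)
      qed
      then show ?thesis using False by (simp add: g_def)
    qed
  qed
  have "(\<lambda>m. \<integral>x. \<bar>orbit_average (s m) f x - g x\<bar> \<partial>M) \<longlonglongrightarrow> (\<integral>x. 0 \<partial>M)"
  proof (rule integral_dominated_convergence[where w = "\<lambda>_. 2 * B"])
    show "AE x in M. (\<lambda>m. \<bar>orbit_average (s m) f x - g x\<bar>) \<longlonglongrightarrow> 0"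
      using conv
    proof eventually_elim
      case (elim x)
      show ?case using lim_g[OF elim] by (simp add: tendsto_rabs_zero_iff LIM_zero_iff)
    qed
    show "AE x in M. norm \<bar>orbit_average (s m) f x - g x\<bar> \<le> 2 * B" for m
    proof (intro AE_I2)
      fix x
      show "norm \<bar>orbit_average (s m) f x - g x\<bar> \<le> 2 * B"
        using orbit_average_bounded[where f = f and n = "s m" and x = x, OF B] gB[of x] by auto
    qed
  qed auto
  then have "\<forall>\<^sub>F m in sequentially. (\<integral>x. \<bar>orbit_average (s m) f x - g x\<bar> \<partial>M) < \<epsilon>"
    using \<epsilon> by (intro order_tendstoD(2)) auto
  then obtain m where "(\<integral>x. \<bar>orbit_average (s m) f x - g x\<bar> \<partial>M) < \<epsilon>"
    by (meson eventually_sequentially order_refl)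
  moreover have "s m > 0" using s(2)[of m] by simp
  ultimately show ?thesis using g gB inv by (intro exI[of _ g] exI[of _ "s m"]) auto
qed

text \<open>The left side is the mean over i < n of f(x) - f(T^i x), and each of these telescopes
  into a coboundary.\<close>

lemma orbit_average_cohomologous:
  assumes [measurable]: "f \<in> borel_measurable M" and B: "\<And>x. \<bar>f x\<bar> \<le> B" and n: "n > 0"
  shows "\<exists>h C. h \<in> borel_measurable M \<and> (\<forall>x. \<bar>h x\<bar> \<le> C) \<and>
    (\<forall>x\<in>space M. f x - orbit_average n f x = h (\<tau> x) - h x)"
proof -
  define h where "h x = - (\<Sum>i<n. \<Sum>q<i. f (T (int q) x)) / real n" for x
  have "h \<in> borel_measurable M" unfolding h_def by measurable
  moreover have "\<bar>h x\<bar> \<le> (\<Sum>i<n. \<Sum>q<i. B) / real n" for x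
    unfolding h_def abs_divide abs_minus_cancel abs_of_nat
    by (intro divide_right_mono order_trans[OF sum_abs] sum_mono B) simp
  moreover have "f x - orbit_average n f x = h (\<tau> x) - h x" if x: "x \<in> space M" for x
  proof -
    have "T (int q) (\<tau> x) = T (int (Suc q)) x" for q
      using T_add[OF x, of "int q" 1] by (simp add: add.commute)
    then have "h (\<tau> x) - h x = - (\<Sum>i<n. \<Sum>q<i. f (T (int (Suc q)) x) - f (T (int q) x)) / real n"
      by (simp add: h_def sum_subtractf diff_divide_distrib del: of_nat_Suc)
    also have "\<dots> = - (\<Sum>i<n. f (T (int i) x) - f (T (int 0) x)) / real n"
      by (subst sum_lessThan_telescope) (rule refl)
    also have "\<dots> = f x - orbit_average n f x"
      using n by (simp add: orbit_average_def sum_subtractf field_simps)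
    finally show ?thesis by simp
  qed
  ultimately show ?thesis by blast
qed

text \<open>Truncate f, write the truncation as an orbit average plus a bounded coboundary, and
  replace the average by its invariant limit. Truncation and replacement cost half of \<epsilon>
  each.\<close>

lemma invariant_plus_coboundary_dense:
  fixes f :: "'a \<Rightarrow> real"
  assumes f: "integrable M f" and \<epsilon>: "\<epsilon> > 0"
  shows "\<exists>g h C. g \<in> borel_measurable M \<and> integrable M g \<and> (\<forall>x\<in>space M. g (\<tau> x) = g x) \<and>
    h \<in> borel_measurable M \<and> (\<forall>x. \<bar>h x\<bar> \<le> C) \<and>
    (\<integral>x. \<bar>f x - g x - (h (\<tau> x) - h x)\<bar> \<partial>M) \<le> \<epsilon>"
proof -
  have [measurable]: "f \<in> borel_measurable M" using f by auto
  note [measurable] = measurable_\<tau>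
  define c where "c n x = max (- real n) (min (real n) (f x))" for n x
  have [measurable]: "c n \<in> borel_measurable M" for n unfolding c_def by measurable
  have cB: "\<bar>c n x\<bar> \<le> real n" for n x by (auto simp: c_def)
  have "(\<lambda>n. \<integral>x. \<bar>f x - c n x\<bar> \<partial>M) \<longlonglongrightarrow> (\<integral>x. 0 \<partial>M)"
  proof (rule integral_dominated_convergence[where w = "\<lambda>x. \<bar>f x\<bar>"])
    show "AE x in M. (\<lambda>n. \<bar>f x - c n x\<bar>) \<longlonglongrightarrow> 0"
    proof (intro AE_I2)
      fix x
      have "\<forall>\<^sub>F n in sequentially. real n \<ge> \<bar>f x\<bar>"
        using eventually_ge_at_top[of "nat \<lceil>\<bar>f x\<bar>\<rceil>"] by eventually_elim linarith
      then have "\<forall>\<^sub>F n in sequentially. \<bar>f x - c n x\<bar> = 0"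
        by eventually_elim (auto simp: c_def)
      then show "(\<lambda>n. \<bar>f x - c n x\<bar>) \<longlonglongrightarrow> 0" by (rule tendsto_eventually)
    qed
    show "AE x in M. norm \<bar>f x - c n x\<bar> \<le> \<bar>f x\<bar>" for n
      by (intro AE_I2) (auto simp: c_def)
  qed (use f in auto)
  then have "\<forall>\<^sub>F n in sequentially. (\<integral>x. \<bar>f x - c n x\<bar> \<partial>M) < \<epsilon> / 2"
    using \<epsilon> by (intro order_tendstoD(2)) auto
  then obtain n where n: "(\<integral>x. \<bar>f x - c n x\<bar> \<partial>M) < \<epsilon> / 2"
    by (meson eventually_sequentially order_refl)
  obtain g m where g: "g \<in> borel_measurable M" "\<And>x. \<bar>g x\<bar> \<le> real n" "\<And>x. x \<in> space M \<Longrightarrow> g (\<tau> x) = g x"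
      "m > 0" "(\<integral>x. \<bar>orbit_average m (c n) x - g x\<bar> \<partial>M) \<le> \<epsilon> / 2"
    using invariant_limit[of "c n" "real n" "\<epsilon> / 2"] cB \<epsilon> by auto
  obtain h C where h: "h \<in> borel_measurable M" "\<And>x. \<bar>h x\<bar> \<le> C"
      "\<And>x. x \<in> space M \<Longrightarrow> c n x - orbit_average m (c n) x = h (\<tau> x) - h x"
  proof -
    have "c n \<in> borel_measurable M" by measurable
    from orbit_average_cohomologous[OF this cB g(4)] show thesis using that by blast
  qed
  note [measurable] = g(1) h(1)
  have intc: "integrable M (c n)" by (rule integrable_bounded[OF _ cB]) measurable
  have intg: "integrable M g" by (rule integrable_bounded[OF g(1,2)])
  have inta: "integrable M (orbit_average m (c n))"
    by (rule integrable_bounded[OF _ orbit_average_bounded[OF cB]]) measurable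
  have "(\<integral>x. \<bar>f x - g x - (h (\<tau> x) - h x)\<bar> \<partial>M)
      = (\<integral>x. \<bar>f x - g x - (c n x - orbit_average m (c n) x)\<bar> \<partial>M)"
    using h(3) by (intro Bochner_Integration.integral_cong refl) simp
  also have "\<dots> \<le> (\<integral>x. \<bar>f x - c n x\<bar> + \<bar>orbit_average m (c n) x - g x\<bar> \<partial>M)"
    using f intc intg inta by (intro integral_mono) auto
  also have "\<dots> = (\<integral>x. \<bar>f x - c n x\<bar> \<partial>M) + (\<integral>x. \<bar>orbit_average m (c n) x - g x\<bar> \<partial>M)"
    using f intc intg inta by (intro Bochner_Integration.integral_add) auto
  also have "\<dots> \<le> \<epsilon>" using n g(5) by simp
  finally show ?thesis using g h(1,2) intg by blast
qed

end

section \<open>Almost everywhere convergence of the truncated averages\<close>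

context weighted_system
begin

lemma V_invariant:
  assumes "x \<in> space M" "\<And>x. x \<in> space M \<Longrightarrow> g (\<tau> x) = g x"
  shows "V k g x = (\<Sum>j\<in>window k. w k j) * g x"
proof -
  have "g (T j x) = g x" for j
  proof (induction j rule: int_induct[where k = 0])
    case (step1 i)
    then show ?case using assms by (simp add: T_succ T_space)
  next
    case (step2 i)
    then show ?case using assms T_succ[of x "i - 1"] by (simp add: T_space)
  qed simp
  then show ?thesis by (simp add: V_def sum_distrib_right)
qed

text \<open>The integrals of the squares are summable, so at almost every point the squares form a
  convergent series.\<close>

lemma AE_V_coboundary_tendsto_0:
  assumes "h \<in> borel_measurable M" "\<And>x. \<bar>h x\<bar> \<le> C"
  shows "AE x in M. (\<lambda>k. V k (\<lambda>x. h (\<tau> x) - h x) x) \<longlonglongrightarrow> 0"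
proof -
  have "AE x in M. summable (\<lambda>k. (V k (\<lambda>x. h (\<tau> x) - h x) x)\<^sup>2)"
  proof (rule AE_summable_of_summable_integrals)
    show "summable (\<lambda>k. \<integral>x. (V k (\<lambda>x. h (\<tau> x) - h x) x)\<^sup>2 \<partial>M)"
    proof (rule summable_comparison_test')
      show "summable (\<lambda>k. (1/4::real) ^ k * C\<^sup>2)"
        by (intro summable_mult2 summable_geometric) simp
      show "norm (\<integral>x. (V k (\<lambda>x. h (\<tau> x) - h x) x)\<^sup>2 \<partial>M) \<le> (1/4) ^ k * C\<^sup>2" for k
        using integral_coboundary_squared_le(1)[OF assms] by simp
    qed
  qed (use integral_coboundary_squared_le(2)[OF assms] in auto)
  then show ?thesis
  proof eventually_elim
    case (elim x)
    from summable_LIMSEQ_zero[OF this] show ?case by simp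
  qed
qed

text \<open>The Banach principle: the dense class converges, and the maximal inequality keeps the
  averages of the approximation error small off a set of small measure.\<close>

lemma AE_convergent_V:
  assumes f: "integrable M f"
  shows "AE x in M. convergent (\<lambda>k. V k f x)"
proof -
  have cauchy: "AE x in M. \<exists>K. \<forall>k\<ge>K. \<forall>l\<ge>K. \<bar>V k f x - V l f x\<bar> \<le> \<delta>" if \<delta>: "\<delta> > 0" for \<delta>
  proof (rule AE_if_exceptional_sets_small)
    fix \<epsilon> :: real assume \<epsilon>: "\<epsilon> > 0"
    \<comment> \<open>Then 4 \<alpha> = \<delta>/4 bounds the averaged error off \<open>E\<close>,
      and an L1 error of \<epsilon> \<alpha>/8 absorbs the constant 8 of the maximal
      inequality.\<close>
    define \<alpha> where "\<alpha> = \<delta> / 16"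
    have \<alpha>: "\<alpha> > 0" using \<delta> by (simp add: \<alpha>_def)
    obtain g h C where gh: "g \<in> borel_measurable M" "integrable M g"
        "\<And>x. x \<in> space M \<Longrightarrow> g (\<tau> x) = g x" "h \<in> borel_measurable M" "\<And>x. \<bar>h x\<bar> \<le> C"
        "(\<integral>x. \<bar>f x - g x - (h (\<tau> x) - h x)\<bar> \<partial>M) \<le> \<epsilon> * \<alpha> / 8"
      using invariant_plus_coboundary_dense[OF f, of "\<epsilon> * \<alpha> / 8"] \<epsilon> \<alpha> by auto
    note [measurable] = gh(1,4) measurable_\<tau> borel_measurable_integrable[OF f]
    define u where "u x = \<bar>f x - g x - (h (\<tau> x) - h x)\<bar>" for x
    have inth: "integrable M h" by (rule integrable_bounded[OF gh(4,5)])
    have u: "integrable M u" unfolding u_def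
      using f gh(2) inth integrable_T[OF inth, of 1] by auto
    define E where "E = {x\<in>space M. \<exists>k. 4 * \<alpha> < V k u x}"
    have [measurable]: "u \<in> borel_measurable M" using u by auto
    have E: "E \<in> sets M" unfolding E_def by measurable
    have "\<alpha> * measure M E \<le> 8 * (\<integral>x. u x \<partial>M)"
      unfolding E_def using u \<alpha> by (intro maximal_inequality) (auto simp: u_def)
    also have "\<dots> \<le> \<epsilon> * \<alpha>" using gh(6) by (simp add: u_def)
    finally have mE: "measure M E \<le> \<epsilon>" using \<alpha> by (simp add: mult.commute)
    have "AE x in M. x \<notin> E \<longrightarrow> (\<exists>K. \<forall>k\<ge>K. \<forall>l\<ge>K. \<bar>V k f x - V l f x\<bar> \<le> \<delta>)"
      using AE_V_coboundary_tendsto_0[OF gh(4,5)] AE_space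
    proof eventually_elim
      case (elim x)
      show ?case
      proof
        assume "x \<notin> E"
        then have uE: "V k u x \<le> \<delta> / 4" for k using elim(2) by (auto simp: E_def \<alpha>_def not_less)
        define v where "v k = V k g x + V k (\<lambda>x. h (\<tau> x) - h x) x" for k
        have "(\<lambda>k. V k g x) \<longlonglongrightarrow> 1 * g x"
          unfolding V_invariant[where g = g, OF elim(2) gh(3), simplified] by (intro tendsto_mult w_mass tendsto_const)
        then have "v \<longlonglongrightarrow> 1 * g x + 0" unfolding v_def by (rule tendsto_add[OF _ elim(1)])
        then have "Cauchy v" by (rule LIMSEQ_imp_Cauchy)
        then obtain K where K: "\<And>k l. k \<ge> K \<Longrightarrow> l \<ge> K \<Longrightarrow> \<bar>v k - v l\<bar> < \<delta> / 2"
          using \<delta> unfolding Cauchy_def dist_real_def by (metis half_gt_zero)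
        have near: "\<bar>V k f x - v k\<bar> \<le> \<delta> / 4" for k
        proof -
          have "V k f x - v k = (\<Sum>j\<in>window k. w k j *
              (f (T j x) - g (T j x) - (h (\<tau> (T j x)) - h (T j x))))"
            by (simp add: v_def V_def algebra_simps sum.distrib sum_subtractf)
          also have "\<bar>\<dots>\<bar> \<le> V k u x"
            unfolding V_def by (rule order_trans[OF sum_abs]) (simp add: u_def abs_mult w_nonneg)
          finally show ?thesis using uE[of k] by linarith
        qed
        have "\<bar>V k f x - V l f x\<bar> \<le> \<delta>" if "k \<ge> K" "l \<ge> K" for k l
          using K[OF that] near[of k] near[of l] by linarith
        then show "\<exists>K. \<forall>k\<ge>K. \<forall>l\<ge>K. \<bar>V k f x - V l f x\<bar> \<le> \<delta>" by blast
      qed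
    qed
    then show "\<exists>E\<in>sets M. measure M E \<le> \<epsilon> \<and>
        (AE x in M. x \<notin> E \<longrightarrow> (\<exists>K. \<forall>k\<ge>K. \<forall>l\<ge>K. \<bar>V k f x - V l f x\<bar> \<le> \<delta>))"
      using E mE by blast
  qed
  \<comment> \<open>Countably many tolerances share one null set.\<close>
  have "AE x in M. \<forall>n::nat. \<exists>K. \<forall>k\<ge>K. \<forall>l\<ge>K. \<bar>V k f x - V l f x\<bar> \<le> 1 / real (Suc n)"
    unfolding AE_all_countable by (intro allI cauchy) simp
  then show ?thesis
  proof eventually_elim
    case (elim x)
    have "Cauchy (\<lambda>k. V k f x)"
      unfolding Cauchy_def dist_real_def
    proof (intro allI impI)
      fix \<epsilon> :: real assume "\<epsilon> > 0"
      then obtain n where n: "inverse (real (Suc n)) < \<epsilon>" using reals_Archimedean by blast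
      obtain K where "\<forall>k\<ge>K. \<forall>l\<ge>K. \<bar>V k f x - V l f x\<bar> \<le> 1 / real (Suc n)" using elim by blast
      then show "\<exists>K. \<forall>k\<ge>K. \<forall>l\<ge>K. \<bar>V k f x - V l f x\<bar> < \<epsilon>"
        using n by (metis inverse_eq_divide order_le_less_trans)
    qed
    then show ?case by (rule Cauchy_convergent)
  qed
qed

end

section \<open>Truncation and choice of the subsequence\<close>

text \<open>A finite tail integral gives summability along with the bound, so \<open>infsum\<close>
  is not at its default value. Applied both to transforms and to sums along an orbit.\<close>

lemma norm_infsum_minus_finite_sum_le:
  fixes a :: "'b \<Rightarrow> complex"
  assumes W: "finite W" and t: "(\<integral>\<^sup>+j. ennreal (norm (a j)) \<partial>count_space (- W)) < \<infinity>"
  shows "ennreal (norm ((\<Sum>\<^sub>\<infinity>j. a j) - (\<Sum>j\<in>W. a j))) \<le> (\<integral>\<^sup>+j. ennreal (norm (a j)) \<partial>count_space (- W))"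
proof -
  have int: "integrable (count_space (- W)) a" using t by (intro integrableI_bounded) auto
  then have abs: "Infinite_Set_Sum.abs_summable_on a (- W)" by (simp add: Infinite_Set_Sum.abs_summable_on_def)
  then have "a summable_on (- W)"
    by (rule abs_summable_summable[OF abs_summable_equivalent[THEN iffD2]])
  then have "infsum a (W \<union> - W) = infsum a W + infsum a (- W)"
    using W by (intro infsum_Un_disjoint) auto
  then have "(\<Sum>\<^sub>\<infinity>j. a j) - (\<Sum>j\<in>W. a j) = infsum a (- W)" using W by simp
  also have "\<dots> = integral\<^sup>L (count_space (- W)) a"
    using infsetsum_infsum[OF abs] by (simp add: infsetsum_def)
  also have "ennreal (norm \<dots>) \<le> ennreal (\<integral>j. norm (a j) \<partial>count_space (- W))"
    by (intro ennreal_leI integral_norm_bound)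
  also have "\<dots> = (\<integral>\<^sup>+j. ennreal (norm (a j)) \<partial>count_space (- W))"
    using int by (intro nn_integral_eq_integral[symmetric]) auto
  finally show ?thesis .
qed

lemma norm_pmf_transform_minus_finite_sum_le:
  fixes p :: "int pmf"
  assumes "finite W"
  shows "norm (fourier_transform p \<gamma> - (\<Sum>j\<in>W. of_real (pmf p j) * e (of_int j * \<gamma>)))
           \<le> measure (measure_pmf p) (- W)"
proof -
  have t: "(\<integral>\<^sup>+j. ennreal (norm (of_real (pmf p j) * e (of_int j * \<gamma>))) \<partial>count_space (- W))
      = emeasure (measure_pmf p) (- W)"
    by (simp add: norm_mult nn_integral_pmf)
  then have "ennreal (norm (fourier_transform p \<gamma> - (\<Sum>j\<in>W. of_real (pmf p j) * e (of_int j * \<gamma>))))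
      \<le> emeasure (measure_pmf p) (- W)"
    unfolding fourier_transform_def using assms
    by (metis norm_infsum_minus_finite_sum_le measure_pmf.emeasure_finite infinity_ennreal_def top.not_eq_extremum)
  then show ?thesis by (simp add: measure_pmf.emeasure_eq_measure)
qed

lemma norm_fourier_transform_le: "norm (fourier_transform p \<gamma>) \<le> 1"
  \<comment> \<open>For empty \<open>W\<close> the tail is the whole mass 1.\<close>
  using norm_pmf_transform_minus_finite_sum_le[of "{}" p \<gamma>] by simp

text \<open>Near both ends of [0, 1), which by periodicity means near 0, the factor 1 - e(\<gamma>)
  is small and the transform at most 1; what is left is a compact subset of (0, 1).\<close>

lemma asymptotically_trivial_transforms_uniform:
  assumes \<mu>: "asymptotically_trivial_transforms \<mu>" and \<epsilon>: "\<epsilon> > 0"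
  shows "\<forall>\<^sub>F n in sequentially. \<forall>\<gamma>. 0 \<le> \<gamma> \<and> \<gamma> < 1 \<longrightarrow> norm ((1 - e \<gamma>) * fourier_transform (\<mu> n) \<gamma>) \<le> \<epsilon>"
proof -
  have "isCont (\<lambda>\<gamma>. 1 - e \<gamma>) 0" unfolding e_def by (intro continuous_intros)
  then have "(\<lambda>\<gamma>. 1 - e \<gamma>) \<midarrow>0\<rightarrow> 0" by (simp add: isCont_def)
  then obtain \<delta> where \<delta>: "\<delta> > 0" "\<And>\<gamma>. \<gamma> \<noteq> 0 \<Longrightarrow> \<bar>\<gamma>\<bar> < \<delta> \<Longrightarrow> norm (1 - e \<gamma>) < \<epsilon>"
    using LIM_D[of "\<lambda>\<gamma>. 1 - e \<gamma>" 0 0 \<epsilon>] \<epsilon> by auto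
  have near0: "norm (1 - e \<gamma>) \<le> \<epsilon>" if "\<bar>\<gamma>\<bar> < \<delta>" for \<gamma>
    using \<delta>(2)[of \<gamma>] that \<epsilon> by (cases "\<gamma> = 0") auto
  define d where "d = min \<delta> (1/2)"
  have d: "d > 0" "d \<le> 1/2" "d \<le> \<delta>" using \<delta>(1) by (auto simp: d_def)
  have "uniform_limit {d..1-d} (\<lambda>n \<gamma>. fourier_transform (\<mu> n) \<gamma>) (\<lambda>_. 0) sequentially"
  proof -
    have "compact {d..1-d} \<and> {d..1-d} \<subseteq> {0<..<1}" using d by auto
    then show ?thesis using \<mu> unfolding asymptotically_trivial_transforms_def by blast
  qed
  then have "\<forall>\<^sub>F n in sequentially. \<forall>\<gamma>\<in>{d..1-d}. dist (fourier_transform (\<mu> n) \<gamma>) 0 < \<epsilon> / 2"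
    by (rule uniform_limitD) (use \<epsilon> in simp)
  then show ?thesis
  proof eventually_elim
    case (elim n)
    show ?case
    proof (intro allI impI)
      fix \<gamma> :: real assume \<gamma>: "0 \<le> \<gamma> \<and> \<gamma> < 1"
      consider "\<gamma> < d" | "\<gamma> > 1 - d" | "\<gamma> \<in> {d..1-d}" by fastforce
      then show "norm ((1 - e \<gamma>) * fourier_transform (\<mu> n) \<gamma>) \<le> \<epsilon>"
      proof cases
        case 3
        have "norm (1 - e \<gamma>) \<le> norm (1::complex) + norm (e \<gamma>)" by (rule norm_triangle_ineq4)
        then have "norm (1 - e \<gamma>) * norm (fourier_transform (\<mu> n) \<gamma>) \<le> 2 * (\<epsilon> / 2)"
          using elim 3 by (intro mult_mono) (auto intro: less_imp_le)
        then show ?thesis by (simp add: norm_mult)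
      next
        case 1
        then have "norm (1 - e \<gamma>) \<le> \<epsilon>" using \<gamma> d by (intro near0) auto
        then have "norm (1 - e \<gamma>) * norm (fourier_transform (\<mu> n) \<gamma>) \<le> \<epsilon> * 1"
          using \<epsilon> by (intro mult_mono norm_fourier_transform_le) auto
        then show ?thesis by (simp add: norm_mult)
      next
        case 2
        have "e \<gamma> = e (\<gamma> - 1) * e 1" by (simp flip: e_add)
        also have "e 1 = 1" by (simp add: e_eq_1_iff)
        finally have "norm (1 - e \<gamma>) = norm (1 - e (\<gamma> - 1))" by simp
        also have "\<dots> \<le> \<epsilon>" using \<gamma> d 2 by (intro near0) auto
        finally have "norm (1 - e \<gamma>) * norm (fourier_transform (\<mu> n) \<gamma>) \<le> \<epsilon> * 1"
          using \<epsilon> by (intro mult_mono norm_fourier_transform_le) auto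
        then show ?thesis by (simp add: norm_mult)
      qed
    qed
  qed
qed

lemma pmf_tail_tendsto_0:
  fixes p :: "int pmf"
  shows "(\<lambda>a. measure (measure_pmf p) (- {- (2 ^ a)..2 ^ a})) \<longlonglongrightarrow> 0"
proof -
  define W where "W a = {- (2 ^ a)..(2::int) ^ a}" for a :: nat
  have "W m \<subseteq> W n" if "m \<le> n" for m n
  proof -
    have "(2::int) ^ m \<le> 2 ^ n" using that by (intro power_increasing) auto
    then show ?thesis by (auto simp: W_def)
  qed
  then have dec: "decseq (\<lambda>a. - W a)" by (auto simp: decseq_def)
  have "x \<in> W (nat \<bar>x\<bar>)" for x
  proof -
    have "int (nat \<bar>x\<bar>) < 2 ^ nat \<bar>x\<bar>" by (rule of_nat_less_two_power)
    then show ?thesis by (auto simp: W_def)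
  qed
  then have "(\<Inter>a. - W a) = {}" by blast
  then show ?thesis
    using measure_pmf.finite_Lim_measure_decseq[of "\<lambda>a. - W a" p] dec by (simp add: W_def)
qed

text \<open>The measure is chosen for the given radius, and the next radius for the tail of that
  measure. Since |1 - e(\<gamma>)| \<le> 2, a tail below \<eta>/4 costs \<eta>/2, the half that the
  full transform leaves over.\<close>

lemma lacunary_subsequence_step:
  assumes \<mu>: "asymptotically_trivial_transforms \<mu>"
  shows "\<exists>n' a'. n < n' \<and> a < a' \<and>
    measure (measure_pmf (\<mu> n')) (- {- (2 ^ a')..2 ^ a'}) \<le> (1/2) ^ k \<and>
    (\<forall>\<gamma>. 0 \<le> \<gamma> \<and> \<gamma> < 1 \<longrightarrow>
       norm ((1 - e \<gamma>) * (\<Sum>j\<in>{- (2 ^ a')..2 ^ a'}. of_real (pmf (\<mu> n') j) * e (of_int j * \<gamma>)))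
         \<le> 1 / (2 ^ k * 2 ^ a))"
proof -
  define \<eta> :: real where "\<eta> = 1 / (2 ^ k * 2 ^ a)"
  have \<eta>: "\<eta> > 0" "\<eta> \<le> (1/2) ^ k" by (auto simp: \<eta>_def power_one_over field_simps)
  have "\<forall>\<^sub>F n' in sequentially. n' > n \<and> (\<forall>\<gamma>. 0 \<le> \<gamma> \<and> \<gamma> < 1 \<longrightarrow>
      norm ((1 - e \<gamma>) * fourier_transform (\<mu> n') \<gamma>) \<le> \<eta> / 2)"
    using \<eta> by (intro eventually_conj eventually_gt_at_top asymptotically_trivial_transforms_uniform[OF \<mu>]) simp
  from eventually_happens'[OF sequentially_bot this] obtain n' where n': "n' > n" "\<And>\<gamma>. 0 \<le> \<gamma> \<Longrightarrow> \<gamma> < 1 \<Longrightarrow>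
      norm ((1 - e \<gamma>) * fourier_transform (\<mu> n') \<gamma>) \<le> \<eta> / 2"
    by blast
  have "\<forall>\<^sub>F a' in sequentially. a' > a \<and> measure (measure_pmf (\<mu> n')) (- {- (2 ^ a')..2 ^ a'}) < \<eta> / 4"
  proof (rule eventually_conj[OF eventually_gt_at_top])
    show "\<forall>\<^sub>F a' in sequentially. measure (measure_pmf (\<mu> n')) (- {- (2 ^ a')..2 ^ a'}) < \<eta> / 4"
      by (rule order_tendstoD(2)[OF pmf_tail_tendsto_0]) (use \<eta> in simp)
  qed
  from eventually_happens'[OF sequentially_bot this] obtain a' where a': "a' > a" "measure (measure_pmf (\<mu> n')) (- {- (2 ^ a')..2 ^ a'}) < \<eta> / 4"
    by blast
  have "norm ((1 - e \<gamma>) * (\<Sum>j\<in>{- (2 ^ a')..2 ^ a'}. of_real (pmf (\<mu> n') j) * e (of_int j * \<gamma>))) \<le> \<eta>"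
    if \<gamma>: "0 \<le> \<gamma>" "\<gamma> < 1" for \<gamma>
  proof -
    define F S where "F = fourier_transform (\<mu> n') \<gamma>"
      and "S = (\<Sum>j\<in>{- (2 ^ a')..2 ^ a'}. of_real (pmf (\<mu> n') j) * e (of_int j * \<gamma>))"
    have "norm (1 - e \<gamma>) \<le> norm (1::complex) + norm (e \<gamma>)" by (rule norm_triangle_ineq4)
    moreover have "norm (F - S) \<le> \<eta> / 4"
      unfolding F_def S_def
      by (rule order_trans[OF norm_pmf_transform_minus_finite_sum_le]) (use a' in auto)
    ultimately have "norm (1 - e \<gamma>) * norm (F - S) \<le> 2 * (\<eta> / 4)" by (intro mult_mono) auto
    moreover have "(1 - e \<gamma>) * S = (1 - e \<gamma>) * F - (1 - e \<gamma>) * (F - S)" by (simp add: algebra_simps)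
    ultimately have "norm ((1 - e \<gamma>) * S) \<le> norm ((1 - e \<gamma>) * F) + 2 * (\<eta> / 4)"
      using norm_triangle_ineq4[of "(1 - e \<gamma>) * F" "(1 - e \<gamma>) * (F - S)"] by (simp add: norm_mult)
    then show ?thesis using n'(2)[OF \<gamma>] by (simp add: F_def S_def)
  qed
  then show ?thesis using n'(1) a' \<eta> unfolding \<eta>_def[symmetric] by (intro exI[of _ n'] exI[of _ a']) auto
qed

lemma lacunary_subsequence:
  assumes \<mu>: "asymptotically_trivial_transforms \<mu>"
  obtains r A where "strict_mono r" "strict_mono A"
    "\<And>k. measure (measure_pmf (\<mu> (r k))) (- {- (2 ^ A (Suc k))..2 ^ A (Suc k)}) \<le> (1/2) ^ k"
    "\<And>k \<gamma>. 0 \<le> \<gamma> \<Longrightarrow> \<gamma> < 1 \<Longrightarrow>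
       norm ((1 - e \<gamma>) * (\<Sum>j\<in>{- (2 ^ A (Suc k))..2 ^ A (Suc k)}. of_real (pmf (\<mu> (r k)) j) * e (of_int j * \<gamma>)))
         \<le> 1 / (2 ^ k * 2 ^ A k)"
proof -
  define Q where "Q k p q \<longleftrightarrow> fst p < fst q \<and> snd p < snd q \<and>
    measure (measure_pmf (\<mu> (fst q))) (- {- (2 ^ snd q)..2 ^ snd q}) \<le> (1/2) ^ k \<and>
    (\<forall>\<gamma>. 0 \<le> \<gamma> \<and> \<gamma> < 1 \<longrightarrow>
       norm ((1 - e \<gamma>) * (\<Sum>j\<in>{- (2 ^ snd q)..2 ^ snd q}. of_real (pmf (\<mu> (fst q)) j) * e (of_int j * \<gamma>)))
         \<le> 1 / (2 ^ k * 2 ^ snd p))" for k :: nat and p q :: "nat \<times> nat"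
  have "\<exists>q. Q k p q" for k p
    using lacunary_subsequence_step[OF \<mu>, of "fst p" "snd p" k] by (auto simp: Q_def)
  then obtain x where x: "\<And>k. Q k (x k) (x (Suc k))"
    using dependent_nat_choice[of "\<lambda>_ _. True" Q] by auto
  show thesis
  proof
    \<comment> \<open>The index shift: the pair at k + 1 holds the k-th measure together with the
      radius that truncates it.\<close>
    show "strict_mono (\<lambda>k. fst (x (Suc k)))" "strict_mono (\<lambda>k. snd (x k))"
      using x by (auto simp: strict_mono_Suc_iff Q_def)
  qed (use x in \<open>auto simp: Q_def\<close>)
qed

text \<open>The integral of the l1 tail along the orbit is the norm of f times the discarded mass,
  hence summable in k, so the tails tend to 0 at almost every point.\<close>

lemma (in dynamical_system) AE_weighted_average_minus_truncation_tendsto_0: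
  assumes f: "integrable M f" and W: "\<And>k. finite (W k)"
    and tail: "\<And>k. measure (measure_pmf (p k)) (- W k) \<le> (1/2) ^ k"
  shows "AE x in M. (\<lambda>k. weighted_average M \<tau> (p k) f x
     - (\<Sum>j\<in>W k. f (T j x) * of_real (pmf (p k) j))) \<longlonglongrightarrow> 0"
proof -
  have [measurable]: "f \<in> borel_measurable M" using f by auto
  define t where "t k x = (\<integral>\<^sup>+j. ennreal (norm (f (T j x) * of_real (pmf (p k) j))) \<partial>count_space (- W k))"
    for k x
  \<comment> \<open>Enumerating the infinite complement turns the tail into a series of measurable
    functions.\<close>
  have t_meas [measurable]: "t k \<in> borel_measurable M" for k
  proof -
    have "infinite (- W k)" using W[of k] finite_compl infinite_UNIV_int by auto
    then have "bij_betw (from_nat_into (- W k)) UNIV (- W k)" by (intro bij_betw_from_nat_into) auto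
    then have "t k x = (\<Sum>n. ennreal (norm (f (T (from_nat_into (- W k) n) x) * of_real (pmf (p k) (from_nat_into (- W k) n)))))"
      for x
      unfolding t_def by (simp add: nn_integral_bij_count_space[symmetric] nn_integral_count_space_nat)
    then show ?thesis by (subst measurable_cong) (auto intro!: borel_measurable_suminf)
  qed
  define c where "c = (\<integral>\<^sup>+x. ennreal (norm (f x)) \<partial>M)"
  have c: "c < \<infinity>" using f by (simp add: c_def integrable_iff_bounded)
  have int_t: "(\<integral>\<^sup>+x. t k x \<partial>M) \<le> c * ennreal ((1/2) ^ k)" for k
  proof -
    have "(\<integral>\<^sup>+x. t k x \<partial>M)
        = (\<integral>\<^sup>+j. (\<integral>\<^sup>+x. ennreal (norm (f (T j x) * of_real (pmf (p k) j))) \<partial>M) \<partial>count_space (- W k))"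
      unfolding t_def by (rule nn_integral_count_space_nn_integral) auto
    also have "\<dots> = (\<integral>\<^sup>+j. c * ennreal (pmf (p k) j) \<partial>count_space (- W k))"
    proof (intro nn_integral_cong)
      fix j
      have "(\<integral>\<^sup>+x. ennreal (norm (f (T j x) * of_real (pmf (p k) j))) \<partial>M)
          = (\<integral>\<^sup>+x. ennreal (norm (f (T j x))) * ennreal (pmf (p k) j) \<partial>M)"
        by (simp add: norm_mult ennreal_mult)
      also have "\<dots> = (\<integral>\<^sup>+x. ennreal (norm (f (T j x))) \<partial>M) * ennreal (pmf (p k) j)"
        by (rule nn_integral_multc) measurable
      also have "(\<integral>\<^sup>+x. ennreal (norm (f (T j x))) \<partial>M) = c"
        unfolding c_def by (rule nn_integral_T) measurable
      finally show "(\<integral>\<^sup>+x. ennreal (norm (f (T j x) * of_real (pmf (p k) j))) \<partial>M) = c * ennreal (pmf (p k) j)" .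
    qed
    also have "\<dots> = c * emeasure (measure_pmf (p k)) (- W k)"
      by (simp add: nn_integral_cmult nn_integral_pmf)
    also have "\<dots> \<le> c * ennreal ((1/2) ^ k)"
      unfolding measure_pmf.emeasure_eq_measure by (intro mult_left_mono ennreal_leI tail) auto
    finally show ?thesis .
  qed
  have "(\<integral>\<^sup>+x. (\<Sum>k. t k x) \<partial>M) = (\<Sum>k. \<integral>\<^sup>+x. t k x \<partial>M)" by (rule nn_integral_suminf) measurable
  also have "\<dots> \<le> (\<Sum>k. c * ennreal ((1/2) ^ k))" by (intro suminf_le int_t) auto
  also have "\<dots> = c * ennreal (\<Sum>k. (1/2) ^ k)"
    by (subst ennreal_suminf_cmult) (auto intro!: arg_cong[where f = "\<lambda>x. c * x"] suminf_ennreal2 summable_geometric)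
  also have "\<dots> < \<infinity>" using c by (simp add: ennreal_mult_less_top)
  finally have "AE x in M. (\<Sum>k. t k x) \<noteq> \<infinity>" by (intro nn_integral_PInf_AE) auto
  then show ?thesis
  proof eventually_elim
    case (elim x)
    have fin: "t k x < \<infinity>" for k
    proof -
      have "t k x \<le> (\<Sum>k. t k x)" using sum_le_suminf[of "\<lambda>k. t k x" "{k}"] by auto
      then show ?thesis using elim by (auto simp: less_top intro: order_le_less_trans)
    qed
    have "summable (\<lambda>k. enn2real (t k x))"
      using elim fin by (intro summable_suminf_not_top) (auto simp: less_top)
    then have "(\<lambda>k. enn2real (t k x)) \<longlonglongrightarrow> 0" by (rule summable_LIMSEQ_zero)
    moreover have "norm (weighted_average M \<tau> (p k) f x - (\<Sum>j\<in>W k. f (T j x) * of_real (pmf (p k) j)))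
        \<le> enn2real (t k x)" for k
    proof -
      have "ennreal (norm (weighted_average M \<tau> (p k) f x - (\<Sum>j\<in>W k. f (T j x) * of_real (pmf (p k) j)))) \<le> t k x"
        unfolding weighted_average_def t_def
        using fin[of k] by (intro norm_infsum_minus_finite_sum_le W) (simp add: t_def)
      from enn2real_mono[OF this] fin[of k] show ?thesis by simp
    qed
    ultimately show ?case
      by (rule Lim_null_comparison[OF always_eventually[OF allI], rotated])
  qed
qed

text \<open>The r built here comes from \<mu> alone, but the statement cannot say so across types;
  it is applied at \<open>int \<Rightarrow> complex\<close>.\<close>

lemma ex_ae_convergent_subsequence:
  assumes "asymptotically_trivial_transforms \<mu>"
  shows "\<exists>r. strict_mono r \<and> ae_convergent_along TYPE('a) \<mu> r"
proof -
  obtain r A where r: "strict_mono r" and A: "strict_mono A"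
    and tail: "\<And>k. measure (measure_pmf (\<mu> (r k))) (- {- (2 ^ A (Suc k))..2 ^ A (Suc k)}) \<le> (1/2) ^ k"
    and hat: "\<And>k \<gamma>. 0 \<le> \<gamma> \<Longrightarrow> \<gamma> < 1 \<Longrightarrow>
       norm ((1 - e \<gamma>) * (\<Sum>j\<in>{- (2 ^ A (Suc k))..2 ^ A (Suc k)}. of_real (pmf (\<mu> (r k)) j) * e (of_int j * \<gamma>)))
         \<le> 1 / (2 ^ k * 2 ^ A k)"
    using lacunary_subsequence[OF assms] by blast
  define W where "W k = {- (2 ^ A (Suc k))..(2::int) ^ A (Suc k)}" for k
  define w where "w k j = (if j \<in> W k then pmf (\<mu> (r k)) j else 0)" for k j
  have sum_w: "(\<Sum>j\<in>W k. w k j) = 1 - measure (measure_pmf (\<mu> (r k))) (- W k)" for k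
  proof -
    have "(\<Sum>j\<in>W k. w k j) = measure (measure_pmf (\<mu> (r k))) (W k)"
      by (simp add: w_def W_def measure_measure_pmf_finite)
    then show ?thesis using measure_pmf.prob_compl[of "W k" "\<mu> (r k)"] by (simp add: Compl_eq_Diff_UNIV)
  qed
  interpret lacunary_weights w A
  proof
    show "(\<Sum>j\<in>{- (2 ^ A (Suc k))..2 ^ A (Suc k)}. w k j) \<le> 1" for k
      unfolding W_def[symmetric] sum_w by simp
    have "(\<lambda>k. measure (measure_pmf (\<mu> (r k))) (- W k)) \<longlonglongrightarrow> 0"
      by (rule Lim_null_comparison[OF always_eventually LIMSEQ_power_zero[of "1/2::real"]])
         (use tail in \<open>auto simp: W_def\<close>)
    from tendsto_diff[OF tendsto_const[of 1] this]
    show "(\<lambda>k. \<Sum>j\<in>{- (2 ^ A (Suc k))..2 ^ A (Suc k)}. w k j) \<longlonglongrightarrow> 1"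
      unfolding W_def[symmetric] sum_w by simp
    fix \<gamma> :: real and k assume \<gamma>: "0 \<le> \<gamma>" "\<gamma> < 1"
    have "(\<Sum>j\<in>W k. of_real (w k j) * e (of_int j * \<gamma>)) = (\<Sum>j\<in>W k. of_real (pmf (\<mu> (r k)) j) * e (of_int j * \<gamma>))"
      by (intro sum.cong) (auto simp: w_def)
    then show "norm ((1 - e \<gamma>) * (\<Sum>j\<in>{- (2 ^ A (Suc k))..2 ^ A (Suc k)}. of_real (w k j) * e (of_int j * \<gamma>)))
         \<le> 1 / (2 ^ k * 2 ^ A k)"
      using hat[OF \<gamma>, of k] by (simp add: W_def)
  qed (use A in \<open>auto simp: w_def W_def\<close>)
  have "AE x in M. convergent (\<lambda>k. weighted_average M \<tau> (\<mu> (r k)) f x)"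
    if "dynamical_system M \<tau>" and f: "integrable M f" for M :: "'a measure" and \<tau> f
  proof -
    interpret dynamical_system M \<tau> by fact
    interpret weighted_system M \<tau> w A ..
    have "AE x in M. (\<lambda>k. weighted_average M \<tau> (\<mu> (r k)) f x
       - (\<Sum>j\<in>W k. f (T j x) * of_real (pmf (\<mu> (r k)) j))) \<longlonglongrightarrow> 0"
      using tail by (intro AE_weighted_average_minus_truncation_tendsto_0 f) (auto simp: W_def)
    moreover have "AE x in M. convergent (\<lambda>k. V k (\<lambda>x. Re (f x)) x)"
      using f by (intro AE_convergent_V) auto
    moreover have "AE x in M. convergent (\<lambda>k. V k (\<lambda>x. Im (f x)) x)"
      using f by (intro AE_convergent_V) auto
    ultimately show ?thesis
    proof eventually_elim
      case (elim x)
      have eq: "(\<Sum>j\<in>W k. f (T j x) * of_real (pmf (\<mu> (r k)) j))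
          = Complex (V k (\<lambda>x. Re (f x)) x) (V k (\<lambda>x. Im (f x)) x)" for k
        unfolding V_def W_def[symmetric] by (simp add: complex_eq_iff w_def mult.commute)
      from elim(2,3) obtain a b where "(\<lambda>k. V k (\<lambda>x. Re (f x)) x) \<longlonglongrightarrow> a" "(\<lambda>k. V k (\<lambda>x. Im (f x)) x) \<longlonglongrightarrow> b"
        by (auto simp: convergent_def)
      from tendsto_add[OF elim(1) tendsto_Complex[OF this]] show ?case
        unfolding eq by (auto intro: convergentI)
    qed
  qed
  then show ?thesis using r unfolding ae_convergent_along_def by blast
qed

text \<open>The orbit map intertwines \<open>\<tau>\<close> with the shift and turns f into the
  coordinate at 0. The weighted averages then agree at every point, so convergence on the sequence
  space pulls back.\<close>

lemma ae_convergent_along_transfer: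
  fixes M :: "'a measure" and f :: "'a \<Rightarrow> complex"
  assumes r: "ae_convergent_along TYPE(int \<Rightarrow> complex) \<mu> r"
    and "dynamical_system M \<tau>" and f: "integrable M f"
  shows "AE x in M. convergent (\<lambda>k. weighted_average M \<tau> (\<mu> (r k)) f x)"
proof -
  interpret dynamical_system M \<tau> by fact
  have [measurable]: "f \<in> borel_measurable M" using f by auto
  note [measurable] = measurable_\<tau>
  define N where "N = Pi\<^sub>M UNIV (\<lambda>_::int. borel :: complex measure)"
  have space_N: "space N = UNIV" by (simp add: N_def space_PiM)
  define \<Phi> where "\<Phi> x = (\<lambda>j. f (T j x))" for x
  have \<Phi> [measurable]: "\<Phi> \<in> M \<rightarrow>\<^sub>M N" unfolding \<Phi>_def N_def by (intro measurable_abs_UNIV) measurable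
  define shift :: "int \<Rightarrow> (int \<Rightarrow> complex) \<Rightarrow> int \<Rightarrow> complex" where "shift i \<omega> = (\<lambda>j. \<omega> (j + i))" for i \<omega>
  have shift [measurable]: "shift i \<in> N \<rightarrow>\<^sub>M N" for i
    unfolding shift_def N_def by (intro measurable_abs_UNIV measurable_component_singleton) simp
  have shift_shift: "shift i (shift j \<omega>) = shift (i + j) \<omega>" for i j \<omega>
    by (simp add: shift_def algebra_simps)
  have shift_0: "shift 0 \<omega> = \<omega>" for \<omega> by (simp add: shift_def)
  \<comment> \<open>Its space is the whole type, so the inverse relative to \<open>space M'\<close>
    is the ordinary \<open>inv\<close>.\<close>
  define M' where "M' = distr M N \<Phi>"
  have sp: "space M' = UNIV" "sets M' = sets N" by (simp_all add: M'_def space_N)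
  have bij: "bij (shift 1)"
    by (rule bij_betw_byWitness[where f' = "shift (-1)"]) (auto simp: shift_shift shift_0)
  have inv: "inv (shift 1) = shift (-1)"
    by (rule inv_unique_comp) (auto simp: shift_shift shift_0 fun_eq_iff)
  have "distr M' M' (shift 1) = distr M' N (shift 1)" by (intro distr_cong) (auto simp: sp)
  also have "\<dots> = distr M N (shift 1 \<circ> \<Phi>)" unfolding M'_def by (intro distr_distr) auto
  also have "\<dots> = distr M N (\<Phi> \<circ> \<tau>)"
  proof (intro distr_cong refl)
    fix x assume x: "x \<in> space M"
    show "(shift 1 \<circ> \<Phi>) x = (\<Phi> \<circ> \<tau>) x"
      using T_add[OF x, of _ 1] by (simp add: shift_def \<Phi>_def)
  qed
  also have "\<dots> = distr (distr M M \<tau>) N \<Phi>" by (intro distr_distr[symmetric]) auto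
  also have "\<dots> = M'" by (simp add: preserving_\<tau> M'_def)
  finally have pres: "distr M' M' (shift 1) = M'" .
  have ds: "dynamical_system M' (shift 1)"
  proof (intro dynamical_system.intro dynamical_system_axioms.intro)
    show "prob_space M'" unfolding M'_def by (rule prob_space_distr[OF \<Phi>])
  qed (use bij pres in \<open>simp_all add: sp inv measurable_cong_sets[OF sp(2) sp(2)]\<close>)
  have comp [measurable]: "(\<lambda>\<omega>. \<omega> 0) \<in> N \<rightarrow>\<^sub>M (borel :: complex measure)"
    unfolding N_def by (rule measurable_component_singleton) simp
  have "integrable M' (\<lambda>\<omega>. \<omega> 0)"
    unfolding M'_def by (subst integrable_distr_eq) (auto simp: \<Phi>_def f)
  then have "AE \<omega> in M'. convergent (\<lambda>k. weighted_average M' (shift 1) (\<mu> (r k)) (\<lambda>\<omega>. \<omega> 0) \<omega>)"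
    using r ds unfolding ae_convergent_along_def by blast
  then have ae: "AE x in M. convergent (\<lambda>k. weighted_average M' (shift 1) (\<mu> (r k)) (\<lambda>\<omega>. \<omega> 0) (\<Phi> x))"
    unfolding M'_def by (rule AE_distrD[OF \<Phi>])
  have pow: "(shift i ^^ n) \<omega> = shift (int n * i) \<omega>" for i n \<omega>
    by (induction n) (simp_all add: shift_0 shift_shift algebra_simps)
  \<comment> \<open>Powers of the shift, negative ones included, bring the j-th coordinate to
    position 0.\<close>
  have "int_iterate M' (shift 1) j \<omega> 0 = \<omega> j" for j \<omega>
    unfolding int_iterate_def sp(1) inv by (auto simp: pow shift_def)
  then have "weighted_average M' (shift 1) p (\<lambda>\<omega>. \<omega> 0) (\<Phi> x) = weighted_average M \<tau> p f x" for p x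
    by (simp add: weighted_average_def \<Phi>_def)
  then show ?thesis using ae by simp
qed

theorem corollary1p4:
  fixes \<mu> :: "nat \<Rightarrow> int pmf"
  assumes "asymptotically_trivial_transforms \<mu>"
  shows "strict_mono (universal_subseq \<mu>) \<and>
    (\<forall>(M :: 'a measure) (\<tau> :: 'a \<Rightarrow> 'a) (f :: 'a \<Rightarrow> complex).
       dynamical_system M \<tau> \<and> integrable M f \<longrightarrow>
       (AE x in M. convergent (\<lambda>k. weighted_average M \<tau> (\<mu> (universal_subseq \<mu> k)) f x)))"
proof -
  have "strict_mono (universal_subseq \<mu>) \<and> ae_convergent_along TYPE(int \<Rightarrow> complex) \<mu> (universal_subseq \<mu>)"
    unfolding universal_subseq_def
    by (rule someI_ex[OF ex_ae_convergent_subsequence[OF assms, where 'a = "int \<Rightarrow> complex"]])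
  then show ?thesis using ae_convergent_along_transfer by blast
qed

end
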